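(* Let $\Gamma$ be an atomic graph and let $\varphi:\Gamma\to\Gamma^e$ be an embedding of $\Gamma$ into its extension graph as an induced (full) subgraph. Then there exist $g\in\mathbb{G}(\Gamma)$ and a graph automorphism $\alpha$ of $\Gamma$ such that $\varphi(\alpha(\Gamma))=\Gamma^g$, where $\Gamma^g$ is the induced subgraph of $\Gamma^e$ on the vertices $\{g^{-1}vg: v\in V(\Gamma)\}$; more precisely, up to conjugation by an element of $\mathbb{G}(\Gamma)$ and a graph automorphism of $\Gamma$, $\varphi$ is the standard inclusion $v\mapsto v$.
   Context: A finite simplicial graph is atomic if it is connected, has no vertices of valence $1$, has no cycles of length less than $5$, and the closed star of no vertex separates it. $\mathbb{G}(\Gamma)$ is the pc group (right-angled Artin group) with generators $V(\Gamma)$ and relations $[u,v]=1$ for each edge. The extension graph $\Gamma^e$ has vertex set $\{g^{-1}xg : x\in V(\Gamma), g\in\mathbb{G}(\Gamma)\}$, two distinct vertices being adjacent iff they commute in $\mathbb{G}(\Gamma)$. *)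

theory Defs
  imports Main
begin

definition simple_graph :: "'v set \<Rightarrow> ('v \<Rightarrow> 'v \<Rightarrow> bool) \<Rightarrow> bool" where
  "simple_graph V E \<longleftrightarrow> finite V \<and> (\<forall>x y. E x y \<longrightarrow> x \<in> V \<and> y \<in> V)
     \<and> (\<forall>x y. E x y \<longrightarrow> E y x) \<and> (\<forall>x. \<not> E x x)"

definition connected_on :: "'v set \<Rightarrow> ('v \<Rightarrow> 'v \<Rightarrow> bool) \<Rightarrow> bool" where
  "connected_on S E \<longleftrightarrow>
     (\<forall>a\<in>S. \<forall>b\<in>S. (\<lambda>x y. x \<in> S \<and> y \<in> S \<and> E x y)\<^sup>*\<^sup>* a b)"

definition closed_star :: "'v set \<Rightarrow> ('v \<Rightarrow> 'v \<Rightarrow> bool) \<Rightarrow> 'v \<Rightarrow> 'v set" where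
  "closed_star V E v = insert v {u \<in> V. E v u}"

definition atomic_graph :: "'v set \<Rightarrow> ('v \<Rightarrow> 'v \<Rightarrow> bool) \<Rightarrow> bool" where
  "atomic_graph V E \<longleftrightarrow>
     simple_graph V E
     \<and> V \<noteq> {}
     \<and> connected_on V E
     \<and> (\<forall>v\<in>V. card {u \<in> V. E v u} \<noteq> 1)
     \<and> (\<forall>a b c. \<not> (E a b \<and> E b c \<and> E c a))
     \<and> (\<forall>a b c d. a \<noteq> c \<and> b \<noteq> d \<longrightarrow> \<not> (E a b \<and> E b c \<and> E c d \<and> E d a))
     \<and> (\<forall>v\<in>V. connected_on (V - closed_star V E v) E)"

definition graph_automorphism :: "'v set \<Rightarrow> ('v \<Rightarrow> 'v \<Rightarrow> bool) \<Rightarrow> ('v \<Rightarrow> 'v) \<Rightarrow> bool" where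
  "graph_automorphism V E \<alpha> \<longleftrightarrow>
     bij_betw \<alpha> V V \<and> (\<forall>u\<in>V. \<forall>v\<in>V. E u v \<longleftrightarrow> E (\<alpha> u) (\<alpha> v))"

text \<open>Right-angled Artin group: elements are represented by words over
letters (x, True) = x and (x, False) = x^-1, with x in V, modulo the
congruence generated by free cancellation and commutation of adjacent
generators.\<close>

type_synonym 'v word = "('v \<times> bool) list"

definition words :: "'v set \<Rightarrow> 'v word set" where
  "words V = lists (V \<times> UNIV)"

inductive raag_eq :: "'v set \<Rightarrow> ('v \<Rightarrow> 'v \<Rightarrow> bool) \<Rightarrow> 'v word \<Rightarrow> 'v word \<Rightarrow> bool"
  for V E where
  refl: "raag_eq V E w w"
| sym: "raag_eq V E u w \<Longrightarrow> raag_eq V E w u"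
| trans: "raag_eq V E u v \<Longrightarrow> raag_eq V E v w \<Longrightarrow> raag_eq V E u w"
| cancel: "x \<in> V \<Longrightarrow> raag_eq V E (u @ [(x, b), (x, \<not> b)] @ w) (u @ w)"
| comm: "E x y \<Longrightarrow> raag_eq V E (u @ [(x, b), (y, c)] @ w) (u @ [(y, c), (x, b)] @ w)"

definition word_inv :: "'v word \<Rightarrow> 'v word" where
  "word_inv w = rev (map (\<lambda>(x, b). (x, \<not> b)) w)"

definition conj_gen :: "'v word \<Rightarrow> 'v \<Rightarrow> 'v word" where
  "conj_gen g x = word_inv g @ [(x, True)] @ g"

definition ext_vertex :: "'v set \<Rightarrow> ('v \<Rightarrow> 'v \<Rightarrow> bool) \<Rightarrow> 'v word \<Rightarrow> bool" where
  "ext_vertex V E w \<longleftrightarrow> (\<exists>g\<in>words V. \<exists>x\<in>V. raag_eq V E w (conj_gen g x))"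

definition raag_commute :: "'v set \<Rightarrow> ('v \<Rightarrow> 'v \<Rightarrow> bool) \<Rightarrow> 'v word \<Rightarrow> 'v word \<Rightarrow> bool" where
  "raag_commute V E u w \<longleftrightarrow> raag_eq V E (u @ w) (w @ u)"

definition induced_ext_embedding ::
  "'v set \<Rightarrow> ('v \<Rightarrow> 'v \<Rightarrow> bool) \<Rightarrow> ('v \<Rightarrow> 'v word) \<Rightarrow> bool" where
  "induced_ext_embedding V E \<phi> \<longleftrightarrow>
     (\<forall>v\<in>V. ext_vertex V E (\<phi> v))
     \<and> (\<forall>u\<in>V. \<forall>v\<in>V. u \<noteq> v \<longrightarrow> \<not> raag_eq V E (\<phi> u) (\<phi> v))
     \<and> (\<forall>u\<in>V. \<forall>v\<in>V. u \<noteq> v \<longrightarrow> (E u v \<longleftrightarrow> raag_commute V E (\<phi> u) (\<phi> v)))"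

end

theory Submission
  imports Defs
begin

text \<open>
  Write every vertex of the extension graph as a conjugate \<open>x\<^sup>g\<close>.  Counting how often a word for
  \<open>g\<close> crosses the hyperplanes on the axis of a generator \<open>u\<close> gives an integer, the level of
  \<open>x\<^sup>g\<close> with respect to \<open>u\<close>, which is constant on the components of the complement of the star
  of \<open>u\<close>.  Sending a vertex outside the standard copy of the graph to a generator with respect to
  which its level is nonzero (its shadow) is a 1-Lipschitz retraction of the extension graph onto
  the standard copy; in particular the extension graph has no squares.

  Let \<open>q v\<close> be the generator of which the image of \<open>v\<close> is a conjugate.  Atomicity says that no
  star of an image vertex separates the image.  Call \<open>K\<close> admissible if it contains an edge and
  the embedding is standard, up to conjugation, on each of \<open>K\<close>, \<open>q K\<close>, \<open>q (q K)\<close>, and so on; every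
  edge is admissible.  Let \<open>K\<close> be admissible of maximal size, and suppose that it is not everything.
  An atomic graph has no cut vertex, so there is a walk outside \<open>K\<close> joining two points of \<open>K\<close>;
  choose such an ear as short as possible, also among all admissible sets of that size.  The shadow
  of the image of an ear of \<open>K\<close> is an ear of \<open>q K\<close>, so it cannot be shorter, and together with
  the absence of squares this forces the image of the ear into the standard copy.  Hence \<open>K\<close>
  together with the ear is admissible, a contradiction.
\<close>

section \<open>Right-angled Artin groups\<close>

lemma words_Nil [simp]: "[] \<in> words A"
  by (simp add: words_def)

lemma words_Cons [simp]: "a # w \<in> words A \<longleftrightarrow> fst a \<in> A \<and> w \<in> words A"
  by (cases a) (auto simp: words_def)

lemma words_append [simp]: "u @ w \<in> words A \<longleftrightarrow> u \<in> words A \<and> w \<in> words A"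
  by (induction u) auto

lemma words_mono: "w \<in> words A \<Longrightarrow> A \<subseteq> B \<Longrightarrow> w \<in> words B"
  by (induction w) auto

lemma word_inv_Nil [simp]: "word_inv [] = []"
  by (simp add: word_inv_def)

lemma word_inv_Cons [simp]: "word_inv (a # w) = word_inv w @ [(fst a, \<not> snd a)]"
  by (cases a) (simp add: word_inv_def)

lemma word_inv_append [simp]: "word_inv (u @ w) = word_inv w @ word_inv u"
  by (simp add: word_inv_def)

lemma word_inv_inv [simp]: "word_inv (word_inv w) = w"
  by (induction w) auto

lemma word_inv_words [simp]: "word_inv w \<in> words A \<longleftrightarrow> w \<in> words A"
  by (induction w) auto

definition restrict_word :: "'v set \<Rightarrow> 'v word \<Rightarrow> 'v word" where
  "restrict_word A w = filter (\<lambda>a. fst a \<in> A) w"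

lemma restrict_word_simps [simp]:
  "restrict_word A [] = []"
  "restrict_word A (a # w) = (if fst a \<in> A then a # restrict_word A w else restrict_word A w)"
  "restrict_word A (u @ w) = restrict_word A u @ restrict_word A w"
  by (auto simp: restrict_word_def)

lemma restrict_word_inv [simp]: "restrict_word A (word_inv w) = word_inv (restrict_word A w)"
  by (induction w) auto

lemma restrict_word_words: "w \<in> words A \<Longrightarrow> restrict_word A w = w"
  by (induction w) auto

lemma restrict_word_in_words [simp]: "restrict_word A w \<in> words A"
  by (induction w) auto

lemma restrict_word_in_words' [simp]: "w \<in> words B \<Longrightarrow> restrict_word A w \<in> words B"
  by (induction w) auto

text \<open>Exponent sum of \<open>x\<close>: a coordinate of the abelianization, hence invariant
  under conjugation.\<close>

fun expo :: "'v \<Rightarrow> 'v word \<Rightarrow> int" where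
  "expo x [] = 0"
| "expo x (a # w) = (if fst a = x then (if snd a then 1 else -1) else 0) + expo x w"

lemma expo_append [simp]: "expo x (u @ w) = expo x u + expo x w"
  by (induction u) auto

lemma expo_inv [simp]: "expo x (word_inv w) = - expo x w"
  by (induction w) auto

section \<open>Calculus in the group\<close>

locale raag =
  fixes V :: "'v set" and E :: "'v \<Rightarrow> 'v \<Rightarrow> bool"
  assumes simple: "simple_graph V E"
begin

abbreviation req :: "'v word \<Rightarrow> 'v word \<Rightarrow> bool" (infix "\<approx>" 50) where
  "u \<approx> w \<equiv> raag_eq V E u w"

abbreviation star :: "'v \<Rightarrow> 'v set" where
  "star \<equiv> closed_star V E"

lemma E_V: "E x y \<Longrightarrow> x \<in> V" "E x y \<Longrightarrow> y \<in> V"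
  using simple by (auto simp: simple_graph_def)

lemma E_sym: "E x y \<Longrightarrow> E y x"
  using simple by (auto simp: simple_graph_def)

lemma E_irrefl: "\<not> E x x"
  using simple by (auto simp: simple_graph_def)

lemma finite_V: "finite V"
  using simple by (auto simp: simple_graph_def)

lemma star_iff: "y \<in> star x \<longleftrightarrow> y = x \<or> E x y"
  using E_V by (auto simp: closed_star_def)

lemma star_sym: "y \<in> star x \<longleftrightarrow> x \<in> star y"
  using E_sym by (auto simp: star_iff)

lemma star_subset: "x \<in> V \<Longrightarrow> star x \<subseteq> V"
  by (auto simp: closed_star_def)

lemmas [trans] = raag_eq.trans
lemmas req_refl [simp, intro] = raag_eq.refl[of V E]
lemmas req_sym = raag_eq.sym[of V E]

lemma req_context: "u \<approx> w \<Longrightarrow> p @ u @ s \<approx> p @ w @ s"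
proof (induction rule: raag_eq.induct)
  case (cancel x u b w)
  then show ?case using raag_eq.cancel[of x V E "p @ u" b "w @ s"] by simp
next
  case (comm x y u b c w)
  then show ?case using raag_eq.comm[of E x y V "p @ u" b c "w @ s"] by simp
qed (rule raag_eq.refl, erule raag_eq.sym, erule (1) raag_eq.trans)

lemma req_append: "u \<approx> u' \<Longrightarrow> w \<approx> w' \<Longrightarrow> u @ w \<approx> u' @ w'"
  using raag_eq.trans[of V E "u @ w" "u' @ w" "u' @ w'"]
    req_context[of u u' "[]" w] req_context[of w w' u' "[]"] by simp

lemma req_append_left: "w \<approx> w' \<Longrightarrow> u @ w \<approx> u @ w'"
  by (rule req_append) auto

lemma req_append_right: "u \<approx> u' \<Longrightarrow> u @ w \<approx> u' @ w"
  by (rule req_append) auto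

lemma raag_commute_cong:
  assumes "u \<approx> u'" "w \<approx> w'" "raag_commute V E u w" shows "raag_commute V E u' w'"
proof -
  have "u' @ w' \<approx> u @ w" using assms(1,2) by (intro req_append[OF req_sym req_sym])
  also have "\<dots> \<approx> w @ u" using assms(3) by (simp add: raag_commute_def)
  also have "\<dots> \<approx> w' @ u'" using assms(1,2) by (intro req_append)
  finally show ?thesis by (simp add: raag_commute_def)
qed

lemma req_words: "u \<approx> w \<Longrightarrow> u \<in> words V \<longleftrightarrow> w \<in> words V"
  by (induction rule: raag_eq.induct) (auto dest: E_V)

lemma word_inv_right: "w \<in> words V \<Longrightarrow> w @ word_inv w \<approx> []"
proof (induction w)
  case (Cons a w)
  have "[a] @ (w @ word_inv w) @ [(fst a, \<not> snd a)] \<approx> [a] @ [] @ [(fst a, \<not> snd a)]"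
    using Cons by (intro req_context) auto
  also have "\<dots> \<approx> []"
    using raag_eq.cancel[of "fst a" V E "[]" "snd a" "[]"] Cons.prems by simp
  finally show ?case by simp
qed simp

lemma word_inv_left: "w \<in> words V \<Longrightarrow> word_inv w @ w \<approx> []"
  using word_inv_right[of "word_inv w"] by simp

lemma req_cancel_left: 
  assumes "p \<in> words V" "p @ u \<approx> p @ w" shows "u \<approx> w"
proof -
  have "u \<approx> (word_inv p @ p) @ u"
    using req_append_right[OF word_inv_left[OF assms(1)], of u] by (simp add: req_sym)
  also have "\<dots> \<approx> (word_inv p @ p) @ w"
    using req_append_left[OF assms(2), of "word_inv p"] by simp
  also have "\<dots> \<approx> w"
    using req_append_right[OF word_inv_left[OF assms(1)], of w] by simp
  finally show ?thesis .
qed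

lemma req_cancel_mid: "p \<in> words V \<Longrightarrow> u @ p @ word_inv p @ w \<approx> u @ w"
  using req_context[OF word_inv_right, of p u w] by simp

lemma req_cancel_mid': "p \<in> words V \<Longrightarrow> u @ word_inv p @ p @ w \<approx> u @ w"
  using req_cancel_mid[of "word_inv p"] by simp

lemma req_cancel_right: 
  assumes "p \<in> words V" "u @ p \<approx> w @ p" shows "u \<approx> w"
proof -
  have "u \<approx> u @ p @ word_inv p" 
    using req_cancel_mid[OF assms(1), of u "[]"] by (simp add: req_sym)
  also have "\<dots> \<approx> w @ p @ word_inv p" 
    using req_append_right[OF assms(2), of "word_inv p"] by simp
  also have "\<dots> \<approx> w" using req_cancel_mid[OF assms(1), of w "[]"] by simp
  finally show ?thesis .
qed

lemma req_inv: 
  assumes "u \<approx> w" "u \<in> words V" shows "word_inv u \<approx> word_inv w"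
proof (rule req_cancel_left[OF assms(2)])
  have w: "w \<in> words V" using assms req_words by blast
  have "u @ word_inv u \<approx> []" using assms(2) by (rule word_inv_right)
  also have "[] \<approx> w @ word_inv w" using word_inv_right[OF w] by (rule req_sym)
  also have "\<dots> \<approx> u @ word_inv w" using req_append_right[OF req_sym[OF assms(1)]] .
  finally show "u @ word_inv u \<approx> u @ word_inv w" .
qed

text \<open>Deletion turns each defining relation into a defining relation or into an identity of
  words.\<close>

lemma req_restrict: "u \<approx> w \<Longrightarrow> restrict_word A u \<approx> restrict_word A w"
proof (induction rule: raag_eq.induct)
  case (cancel x u b w)
  then show ?case using raag_eq.cancel[of x V E "restrict_word A u" b "restrict_word A w"] by simp
next
  case (comm x y u b c w)
  then show ?case 
    using raag_eq.comm[of E x y V "restrict_word A u" b c "restrict_word A w"] by simp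
qed (rule raag_eq.refl, erule raag_eq.sym, erule (1) raag_eq.trans)

lemma req_expo: "u \<approx> w \<Longrightarrow> expo x u = expo x w"
  by (induction rule: raag_eq.induct) auto

section \<open>Subgroups generated by sets of generators\<close>

text \<open>The subgroup generated by \<open>A\<close>; membership is decided by the retraction that deletes the
  letters outside \<open>A\<close>.\<close>

definition in_sub :: "'v set \<Rightarrow> 'v word \<Rightarrow> bool" where
  "in_sub A w \<longleftrightarrow> w \<approx> restrict_word A w"

lemma in_subI: "w \<in> words A \<Longrightarrow> in_sub A w"
  by (simp add: in_sub_def restrict_word_words)

lemma in_sub_cong: 
  assumes "u \<approx> w" shows "in_sub A u \<longleftrightarrow> in_sub A w"
proof -
  have r: "restrict_word A u \<approx> restrict_word A w" using assms by (rule req_restrict)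
  show ?thesis unfolding in_sub_def
    using raag_eq.trans[OF req_sym[OF assms] raag_eq.trans[OF _ r]]
      raag_eq.trans[OF assms raag_eq.trans[OF _ req_sym[OF r]]] by iprover
qed

lemma in_sub_append: "in_sub A u \<Longrightarrow> in_sub A w \<Longrightarrow> in_sub A (u @ w)"
  by (simp add: in_sub_def req_append)

lemma in_sub_inv: "in_sub A u \<Longrightarrow> u \<in> words V \<Longrightarrow> in_sub A (word_inv u)"
  by (simp add: in_sub_def req_inv)

lemma in_sub_append_left: 
  assumes "in_sub A u" "u \<in> words V" shows "in_sub A (u @ w) \<longleftrightarrow> in_sub A w"
proof
  assume "in_sub A (u @ w)"
  then have "in_sub A (word_inv u @ u @ w)" using in_sub_append[OF in_sub_inv[OF assms]] by blast
  then show "in_sub A w" using in_sub_cong[OF req_cancel_mid'[OF assms(2), of "[]" w]] by simp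
qed (use assms in_sub_append in auto)

lemma in_sub_append_right: 
  assumes "in_sub A u" "u \<in> words V" shows "in_sub A (w @ u) \<longleftrightarrow> in_sub A w"
proof
  assume "in_sub A (w @ u)"
  then have "in_sub A ((w @ u) @ word_inv u)" using in_sub_append[OF _ in_sub_inv[OF assms]] by blast
  then show "in_sub A w" using in_sub_cong[OF req_cancel_mid[OF assms(2), of w "[]"]] by simp
qed (use assms in_sub_append in auto)

lemma in_sub_Cons: "fst a \<in> A \<Longrightarrow> fst a \<in> V \<Longrightarrow> in_sub A (a # w) \<longleftrightarrow> in_sub A w"
  using in_sub_append_left[of A "[a]" w] in_subI[of "[a]" A] by simp

lemma letter_commute:
  assumes "x \<in> V" "y \<in> star x" shows "[(x, b), (y, c)] \<approx> [(y, c), (x, b)]"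
proof (cases "y = x")
  case True
  then show ?thesis
  proof (cases "b = c")
    case False
    have "[(x, b), (x, \<not> b)] \<approx> []" using raag_eq.cancel[of x V E "[]" b "[]"] assms by simp
    also have "[] \<approx> [(x, \<not> b), (x, b)]"
      using raag_eq.cancel[of x V E "[]" "\<not> b" "[]"] assms by (simp add: req_sym)
    finally show ?thesis using True False by simp
  qed simp
qed (use raag_eq.comm[of E x y V "[]" b c "[]"] assms in \<open>simp add: star_iff\<close>)

lemma star_commute: 
  assumes "in_sub (star x) s" "x \<in> V" shows "(x, b) # s \<approx> s @ [(x, b)]"
proof -
  have *: "(x, b) # w \<approx> w @ [(x, b)]" if "w \<in> words (star x)" for w
    using that
  proof (induction w)
    case (Cons a w)
    have "[(x, b), a] @ w \<approx> [a, (x, b)] @ w"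
      using letter_commute[OF assms(2), of "fst a" b "snd a"] Cons.prems 
      by (intro req_append_right) simp
    also have "\<dots> \<approx> [a] @ w @ [(x, b)]"
      using req_append_left[of "(x, b) # w" "w @ [(x, b)]" "[a]"] Cons by simp
    finally show ?case by simp
  qed simp
  have s: "s \<approx> restrict_word (star x) s" using assms(1) by (simp add: in_sub_def)
  have "[(x, b)] @ s \<approx> [(x, b)] @ restrict_word (star x) s" using s by (rule req_append_left)
  also have "\<dots> \<approx> restrict_word (star x) s @ [(x, b)]" using * by simp
  also have "\<dots> \<approx> s @ [(x, b)]" using req_append_right[OF req_sym[OF s]] .
  finally show ?thesis by simp
qed

section \<open>Crossing numbers and centralizers\<close>

text \<open>In the Cayley graph, left multiplication by \<open>u\<close> at an element of \<open>\<langle>star u\<rangle>\<close> crosses one of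
  the hyperplanes along the axis of \<open>u\<close>; \<open>crossing u\<close> counts these crossings with sign.  It is
  visibly compatible with the defining relations, and it replaces normal forms throughout.\<close>

fun crossing :: "'v \<Rightarrow> 'v word \<Rightarrow> int" where
  "crossing u [] = 0"
| "crossing u (a # w) =
     (if fst a = u \<and> in_sub (star u) w then (if snd a then 1 else -1) else 0) + crossing u w"

text \<open>A letter is counted according to the group element to its right, so a relation need only
  be tested at the left end of a word.\<close>

lemma crossing_prefix: "s \<approx> s' \<Longrightarrow> crossing u s = crossing u s' \<Longrightarrow> crossing u (p @ s) = crossing u (p @ s')"
proof (induction p)
  case (Cons a p)
  then show ?case using in_sub_cong[OF req_append_left[of s s' p], of "star u"] by simp
qed simp

text \<open>For a cancelling pair, both letters pass or fail the same membership test and have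
  opposite signs. For a commuting pair, the partner lies in the star and does not affect the
  test.\<close>

lemma crossing_cong: "w \<approx> w' \<Longrightarrow> crossing u w = crossing u w'"
proof (induction rule: raag_eq.induct)
  case (cancel x p b w)
  show ?case
  proof (rule crossing_prefix)
    show "[(x, b), (x, \<not> b)] @ w \<approx> w" using raag_eq.cancel[of x V E "[]" b w] cancel by simp
    have "in_sub (star x) ((x, \<not> b) # w) \<longleftrightarrow> in_sub (star x) w"
      using cancel by (intro in_sub_Cons) (auto simp: star_iff)
    then show "crossing u ([(x, b), (x, \<not> b)] @ w) = crossing u w" by (cases b) auto
  qed
next
  case (comm x y p b c w)
  show ?case
  proof (rule crossing_prefix)
    show "[(x, b), (y, c)] @ w \<approx> [(y, c), (x, b)] @ w" 
      using raag_eq.comm[of E x y V "[]" b c w] comm by simp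
    have "in_sub (star x) ((y, c) # w) \<longleftrightarrow> in_sub (star x) w"
      "in_sub (star y) ((x, b) # w) \<longleftrightarrow> in_sub (star y) w"
      using comm by (auto intro!: in_sub_Cons simp: star_iff dest: E_V E_sym)
    then show "crossing u ([(x, b), (y, c)] @ w) = crossing u ([(y, c), (x, b)] @ w)"
      using comm E_irrefl by (cases b; cases c; auto)
  qed
qed auto

text \<open>Right multiplication by an element of the subgroup of \<open>star u\<close> changes no
  membership test for letters of \<open>w\<close>.\<close>

lemma crossing_append_star:
  assumes "in_sub (star u) s" "s \<in> words V"
  shows "crossing u (w @ s) = crossing u w + crossing u s"
  by (induction w) (use in_sub_append_right[OF assms] in auto)

lemma crossing_eq_0: "w \<in> words A \<Longrightarrow> u \<notin> A \<Longrightarrow> crossing u w = 0"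
  by (induction w) auto

lemma crossing_eq_0_sub: "in_sub A w \<Longrightarrow> u \<notin> A \<Longrightarrow> crossing u w = 0"
  using crossing_cong[of w "restrict_word A w" u] crossing_eq_0[of "restrict_word A w" A u]
  by (simp add: in_sub_def)

text \<open>Just after a letter \<open>u\<close> is counted, the suffix read so far lies in the
  subgroup of \<open>star u\<close>, where a generator outside \<open>star u\<close> has crossing
  number 0. So on every suffix at least one of the two counts vanishes.\<close>

lemma crossing_clique: 
  assumes "w \<in> words V" "crossing u w \<noteq> 0" "crossing u' w \<noteq> 0"
  shows "u' \<in> star u"
proof (rule ccontr)
  assume n: "u' \<notin> star u"
  then have n': "u \<notin> star u'" using star_sym by blast
  have "crossing u w = 0 \<or> crossing u' w = 0"
    using assms(1)
  proof (induction w)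
    case (Cons a w)
    have *: "crossing v' (a # w) = 0" 
      if "fst a = v" "in_sub (star v) w" "v' \<notin> star v" for v v'
    proof (rule crossing_eq_0_sub)
      show "in_sub (star v) (a # w)" using that Cons.prems in_sub_Cons[of a "star v" w]
        by (simp add: star_iff)
    qed fact
    show ?case 
      using *[of u u'] *[of u' u] n n' Cons by (auto split: if_splits)
  qed simp
  with assms show False by simp
qed

text \<open>The sign forces some letter \<open>(u, b)\<close> to be counted; it commutes with the
  suffix behind it and can be moved to the right end. Keeping track of the length makes this usable
  for shortening words.\<close>

lemma crossing_pos_ends:
  assumes "w \<in> words V" "crossing u w * (if b then 1 else -1) > 0"
  shows "\<exists>w'\<in>words V. w \<approx> w' @ [(u, b)] \<and> length w = Suc (length w')"
  using assms
proof (induction w)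
  case (Cons a w)
  show ?case
  proof (cases "a = (u, b) \<and> in_sub (star u) w")
    case True
    then show ?thesis using star_commute[of u w b] Cons.prems by auto
  next
    case False
    then have "crossing u w * (if b then 1 else -1) > 0"
      using Cons.prems by (cases a) (auto split: if_splits)
    then obtain w' where w': "w' \<in> words V" "w \<approx> w' @ [(u, b)]" "length w = Suc (length w')"
      using Cons by auto
    then have "[a] @ w \<approx> [a] @ w' @ [(u, b)]" by (intro req_append_left)
    then show ?thesis using w' Cons.prems by (intro bexI[of _ "a # w'"]) auto
  qed
qed simp

text \<open>Compare crossing numbers: on the right the extra letter always contributes 1, on the
  left only if \<open>g\<close> lies in the subgroup of \<open>star x\<close>.\<close>

lemma centralizer:
  assumes "x \<in> V" "g \<in> words V" "(x, True) # g \<approx> g @ [(x, True)]"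
  shows "in_sub (star x) g"
proof -
  have x: "in_sub (star x) [(x, True)]" by (rule in_subI) (simp add: star_iff)
  have "crossing x ((x, True) # g) = crossing x g + crossing x [(x, True)]"
    using crossing_cong[OF assms(3), of x] crossing_append_star[OF x, of g] assms by simp
  then show ?thesis using in_subI[of "[]" "star x"] by (auto split: if_splits)
qed

end

section \<open>The extension graph\<close>

text \<open>A pair \<open>(x, g)\<close> names the vertex g^-1 x g. Generator and conjugator stay at
  hand, but several pairs name one vertex, so equality of vertices is \<open>veq\<close>
  below.\<close>

definition vx :: "'v \<times> 'v word \<Rightarrow> 'v word" where
  "vx y = conj_gen (snd y) (fst y)"

definition act :: "'v word \<Rightarrow> 'v \<times> 'v word \<Rightarrow> 'v \<times> 'v word" where
  "act h y = (fst y, snd y @ h)"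

abbreviation base :: "'v \<Rightarrow> 'v \<times> 'v word" where
  "base x \<equiv> (x, [])"

lemma fst_act [simp]: "fst (act h y) = fst y"
  by (simp add: act_def)

lemma act_act: "act k (act h y) = act (h @ k) y"
  by (simp add: act_def)

lemma vx_pair: "vx (x, g) = word_inv g @ [(x, True)] @ g"
  by (simp add: vx_def conj_gen_def)

lemma vx_act: "vx (act h y) = word_inv h @ vx y @ h"
  by (simp add: vx_def act_def conj_gen_def)

section \<open>Equality and adjacency in the extension graph\<close>

context raag
begin

abbreviation vert :: "('v \<times> 'v word) set" where
  "vert \<equiv> V \<times> words V"

definition veq :: "'v \<times> 'v word \<Rightarrow> 'v \<times> 'v word \<Rightarrow> bool" where
  "veq y z \<longleftrightarrow> vx y \<approx> vx z"

definition vcomm :: "'v \<times> 'v word \<Rightarrow> 'v \<times> 'v word \<Rightarrow> bool" where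
  "vcomm y z \<longleftrightarrow> raag_commute V E (vx y) (vx z)"

definition vadj :: "'v \<times> 'v word \<Rightarrow> 'v \<times> 'v word \<Rightarrow> bool" where
  "vadj y z \<longleftrightarrow> vcomm y z \<and> \<not> veq y z"

lemma act_vert [simp]: "h \<in> words V \<Longrightarrow> act h y \<in> vert \<longleftrightarrow> y \<in> vert"
  by (cases y) (auto simp: act_def)

lemma vx_words [simp]: "y \<in> vert \<Longrightarrow> vx y \<in> words V"
  by (cases y) (auto simp: vx_pair)

lemma veq_refl [simp]: "veq y y"
  by (simp add: veq_def)

lemma veq_sym: "veq y z \<Longrightarrow> veq z y"
  by (simp add: veq_def req_sym)

lemma veq_trans [trans]: "veq x y \<Longrightarrow> veq y z \<Longrightarrow> veq x z"
  unfolding veq_def by (rule raag_eq.trans)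

lemma vcomm_refl [simp]: "vcomm y y"
  by (simp add: vcomm_def raag_commute_def)

lemma vcomm_sym: "vcomm y z \<Longrightarrow> vcomm z y"
  by (simp add: vcomm_def raag_commute_def req_sym)

lemma vadj_sym: "vadj y z \<Longrightarrow> vadj z y"
  unfolding vadj_def using vcomm_sym veq_sym by blast

lemma vcomm_cong_imp: "veq y y' \<Longrightarrow> veq z z' \<Longrightarrow> vcomm y z \<Longrightarrow> vcomm y' z'"
  unfolding veq_def vcomm_def by (rule raag_commute_cong)

lemma vcomm_cong: "veq y y' \<Longrightarrow> veq z z' \<Longrightarrow> vcomm y z \<longleftrightarrow> vcomm y' z'"
  using vcomm_cong_imp[of y y' z z'] vcomm_cong_imp[of y' y z' z] veq_sym[of y y'] veq_sym[of z z']
  by argo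

lemma veq_cong: "veq y y' \<Longrightarrow> veq z z' \<Longrightarrow> veq y z \<longleftrightarrow> veq y' z'"
  using veq_trans[of y' y z] veq_trans[of y' z z'] veq_trans[of y y' z'] veq_trans[of y z' z]
    veq_sym[of y y'] veq_sym[of z z'] by argo

lemma vadj_cong: "veq y y' \<Longrightarrow> veq z z' \<Longrightarrow> vadj y z \<longleftrightarrow> vadj y' z'"
  unfolding vadj_def using vcomm_cong[of y y' z z'] veq_cong[of y y' z z'] by argo

lemma veq_vcomm: "veq y z \<Longrightarrow> vcomm y z"
  using vcomm_cong[of y y y z] by simp

lemma req_conj_iff: 
  assumes "h \<in> words V" 
  shows "word_inv h @ u @ h \<approx> word_inv h @ w @ h \<longleftrightarrow> u \<approx> w"
  using req_context[of u w] req_cancel_left[of "word_inv h" "u @ h" "w @ h"] 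
    req_cancel_right[of h u w] assms by auto

lemma veq_act [simp]: "h \<in> words V \<Longrightarrow> veq (act h y) (act h z) \<longleftrightarrow> veq y z"
  by (simp add: veq_def vx_act req_conj_iff)

lemma vcomm_act [simp]: 
  assumes "h \<in> words V" shows "vcomm (act h y) (act h z) \<longleftrightarrow> vcomm y z"
proof -
  have *: "vx (act h y) @ vx (act h z) \<approx> word_inv h @ (vx y @ vx z) @ h" for y z
    using req_cancel_mid[OF assms, of "word_inv h @ vx y" "vx z @ h"] by (simp add: vx_act)
  have "vcomm (act h y) (act h z) \<longleftrightarrow> 
      word_inv h @ (vx y @ vx z) @ h \<approx> word_inv h @ (vx z @ vx y) @ h"
    unfolding vcomm_def raag_commute_def
    using raag_eq.trans[OF req_sym[OF *[of y z]] raag_eq.trans[OF _ *[of z y]]]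
      raag_eq.trans[OF *[of y z] raag_eq.trans[OF _ req_sym[OF *[of z y]]]] by argo
  also have "\<dots> \<longleftrightarrow> vcomm y z"
    unfolding vcomm_def raag_commute_def by (rule req_conj_iff[OF assms])
  finally show ?thesis .
qed

lemma vadj_act [simp]: "h \<in> words V \<Longrightarrow> vadj (act h y) (act h z) \<longleftrightarrow> vadj y z"
  by (simp add: vadj_def)

text \<open>Exponent sums survive conjugation and tell the generators apart.\<close>

lemma veq_fst: "veq y z \<Longrightarrow> fst y = fst z"
  using req_expo[of "vx y" "vx z" "fst y"]
  by (cases y; cases z) (auto simp: veq_def vx_pair split: if_splits)

lemma veq_word: "g \<in> words V \<Longrightarrow> g \<approx> h \<Longrightarrow> veq (x, g) (x, h)"
  using req_append[OF req_inv[of g h] req_append_left[of g h "[(x, True)]"]]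
  by (simp add: veq_def vx_pair)

lemma veq_sub: 
  assumes "x \<in> V" "s \<in> words V" "in_sub (star x) s" 
  shows "veq (x, s @ g) (x, g)"
proof -
  have "word_inv g @ (word_inv s @ ((x, True) # s)) @ g \<approx> 
      word_inv g @ (word_inv s @ (s @ [(x, True)])) @ g"
    using assms by (intro req_context req_append_left star_commute)
  also have "\<dots> \<approx> word_inv g @ [(x, True)] @ g"
    using req_cancel_mid'[OF assms(2), of "word_inv g" "[(x, True)] @ g"] by simp
  finally show ?thesis by (simp add: veq_def vx_pair)
qed

text \<open>The quotient \<open>k\<close> of the two conjugators centralizes \<open>x\<close>, hence
  lies in the subgroup of \<open>star x\<close>; its restriction serves as \<open>s\<close>.\<close>

lemma veqE: 
  assumes "veq (x, g) (x, h)" "x \<in> V" "g \<in> words V" "h \<in> words V"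
  obtains s where "s \<in> words (star x)" "h \<approx> s @ g"
proof -
  define k where "k = h @ word_inv g"
  have "(x, True) # k \<approx> h @ vx (x, h) @ word_inv g"
    using req_cancel_mid[OF assms(4), of "[]" "(x, True) # h @ word_inv g"]
    by (simp add: k_def vx_pair req_sym)
  also have "\<dots> \<approx> h @ vx (x, g) @ word_inv g"
    using req_context[OF req_sym[OF assms(1)[unfolded veq_def]]] .
  also have "\<dots> \<approx> k @ [(x, True)]"
    using req_cancel_mid[OF assms(3), of "h @ word_inv g @ [(x, True)]" "[]"]
    by (simp add: k_def vx_pair)
  finally have "in_sub (star x) k"
    using assms by (intro centralizer) (auto simp: k_def)
  then have s: "restrict_word (star x) k \<approx> k" by (simp add: in_sub_def req_sym)
  have "h \<approx> k @ g" using req_cancel_mid'[OF assms(3), of h "[]"] by (simp add: k_def req_sym)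
  also have "\<dots> \<approx> restrict_word (star x) k @ g" 
    using req_append_right[OF req_sym[OF s]] .
  finally show thesis using that[of "restrict_word (star x) k"] by simp
qed

lemma vadj_conj: 
  assumes "E a b" "k \<in> words V" shows "vadj (a, k) (b, k)"
proof -
  have "vcomm (base a) (base b)"
    using letter_commute[of a b True True] assms E_V
    by (simp add: vcomm_def raag_commute_def vx_pair star_iff)
  then have "vcomm (act k (base a)) (act k (base b))" using assms by simp
  then have "vcomm (a, k) (b, k)" by (simp add: act_def)
  moreover have "\<not> veq (a, k) (b, k)" using veq_fst[of "(a, k)" "(b, k)"] assms E_irrefl by auto
  ultimately show ?thesis by (simp add: vadj_def)
qed

text \<open>Conjugating by the inverse of \<open>g\<close> reduces to the pair \<open>a\<close> and
  \<open>(b, k)\<close>. Then \<open>c\<close>, which is k a k^-1, centralizes \<open>b\<close>, and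
  retracting it to the subgroup of \<open>star b\<close> replaces \<open>k\<close> by
  \<open>k'\<close> in that subgroup. Hence \<open>m\<close>, which is k'^-1 k, centralizes
  \<open>a\<close>, and \<open>m @ g\<close> conjugates both generators correctly.\<close>

lemma vcomm_common_conjugator:
  assumes y: "(a, g) \<in> vert" and z: "(b, h) \<in> vert" and comm: "vcomm (a, g) (b, h)"
  shows "veq (a, g) (b, h) \<or> E a b \<and> (\<exists>k\<in>words V. veq (a, g) (a, k) \<and> veq (b, h) (b, k))"
proof -
  define k where "k = h @ word_inv g"
  define c where "c = k @ [(a, True)] @ word_inv k"
  define k' where "k' = restrict_word (star b) k"
  define m where "m = word_inv k' @ k"
  have words: "a \<in> V" "b \<in> V" "g \<in> words V" "h \<in> words V" "k \<in> words V" "k' \<in> words V" 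
      "m \<in> words V" "c \<in> words V"
    using y z by (auto simp: k_def k'_def m_def c_def)
  have "vcomm (act (word_inv g) (a, g)) (act (word_inv g) (b, h))" 
    using comm words by simp
  moreover have "veq (act (word_inv g) (a, g)) (base a)"
    using words by (auto simp: act_def intro!: veq_word word_inv_right)
  moreover have "act (word_inv g) (b, h) = (b, k)" by (simp add: act_def k_def)
  ultimately have "vcomm (base a) (b, k)"
    using vcomm_cong_imp[of _ "base a" "(b, k)" "(b, k)"] veq_refl by metis
  then have ck: "[(a, True)] @ vx (b, k) \<approx> vx (b, k) @ [(a, True)]" 
    by (simp add: vcomm_def raag_commute_def vx_pair)
  have "(b, True) # c \<approx> k @ (vx (b, k) @ [(a, True)]) @ word_inv k"
    using req_cancel_mid[OF words(5), of "[]" "(b, True) # c"] 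
    by (simp add: c_def vx_pair req_sym)
  also have "\<dots> \<approx> k @ ([(a, True)] @ vx (b, k)) @ word_inv k"
    using req_context[OF req_sym[OF ck]] .
  also have "\<dots> \<approx> c @ [(b, True)]"
    using req_cancel_mid[OF words(5), of "c @ [(b, True)]" "[]"] by (simp add: c_def vx_pair)
  finally have "in_sub (star b) c" using words by (intro centralizer)
  then have c: "c \<approx> k' @ restrict_word (star b) [(a, True)] @ word_inv k'"
    by (simp add: in_sub_def c_def k'_def split: if_splits)
  \<comment> \<open>The exponent of \<open>a\<close> in \<open>c\<close> is 1, so the retraction
    cannot have deleted \<open>a\<close>.\<close>
  have ab: "a \<in> star b"
    using req_expo[OF c, of a] by (auto simp: c_def split: if_splits)
  have "(a, True) # m \<approx> word_inv k' @ (k' @ [(a, True)] @ word_inv k') @ k"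
    using req_cancel_mid'[OF words(6), of "[]" "(a, True) # m"] by (simp add: m_def req_sym)
  also have "\<dots> \<approx> word_inv k' @ c @ k"
    using req_context[OF req_sym[OF c]] ab by simp
  also have "\<dots> \<approx> m @ [(a, True)]"
    using req_cancel_mid'[OF words(5), of "word_inv k' @ k @ [(a, True)]" "[]"]
    by (simp add: m_def c_def)
  finally have m: "in_sub (star a) m" using words by (intro centralizer)
  have a: "veq (a, g) (a, m @ g)" using veq_sub[OF words(1) words(7) m] by (rule veq_sym)
  have k': "in_sub (star b) k'" by (auto simp: k'_def intro: in_subI)
  have "k' @ m @ g \<approx> k @ g"
    using req_cancel_mid[OF words(6), of "[]" "k @ g"] by (simp add: m_def)
  also have "\<dots> \<approx> h"
    using req_cancel_mid'[OF words(3), of h "[]"] by (simp add: k_def)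
  finally have "veq (b, k' @ m @ g) (b, h)" using words by (intro veq_word) auto
  then have b: "veq (b, h) (b, m @ g)"
    by (rule veq_trans[OF veq_sym veq_sub[OF words(2) words(6) k']])
  show ?thesis
  proof (cases "a = b")
    case True
    then show ?thesis using veq_trans[OF a veq_sym[of "(b, h)"]] b by simp
  next
    case False
    then show ?thesis using a b ab E_sym words by (auto simp: star_iff intro!: bexI[of _ "m @ g"])
  qed
qed

lemma vadjE:
  assumes "vadj y z" "y \<in> vert" "z \<in> vert"
  obtains k where "E (fst y) (fst z)" "k \<in> words V" "veq y (fst y, k)" "veq z (fst z, k)"
  using vcomm_common_conjugator[of "fst y" "snd y" "fst z" "snd z"] assms
  by (auto simp: vadj_def)

abbreviation vstar :: "'v \<Rightarrow> 'v \<times> 'v word \<Rightarrow> bool" where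
  "vstar u y \<equiv> vcomm y (base u)"

section \<open>Levels\<close>

text \<open>A vertex that does not commute with \<open>u\<close> lies in a component of the complement of the star
  of \<open>u\<close> in the extension graph; these components are indexed by the integers through
  \<open>level u\<close>.\<close>

definition level :: "'v \<Rightarrow> 'v \<times> 'v word \<Rightarrow> int" where
  "level u y = crossing u (snd y)"

lemma vstar_fixes: 
  assumes "x \<in> star u" "u \<in> V" "in_sub (star u) g" "g \<in> words V" 
  shows "vstar u (x, g)"
proof -
  have "vcomm (base x) (base u)"
    using letter_commute[OF assms(2,1), of True True] 
    by (simp add: vcomm_def raag_commute_def vx_pair req_sym)
  then have "vcomm (act g (base x)) (act g (base u))" using assms by simp
  then show ?thesis
    using vcomm_cong[of "(x, g)" "(x, g)" "(u, g)" "base u"] veq_sub[of u g "[]"] assms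
    by (simp add: act_def)
qed

text \<open>Two conjugators of one vertex differ by a word \<open>s\<close> over
  \<open>star x\<close>. If a letter \<open>u\<close> of \<open>s\<close> were counted, the vertex
  would commute with \<open>u\<close>.\<close>

lemma level_veq:
  assumes "y \<in> vert" "z \<in> vert" "veq y z" "u \<in> V" "\<not> vstar u y"
  shows "level u y = level u z"
proof -
  obtain x g h where yz: "y = (x, g)" "z = (x, h)"
    using veq_fst[OF assms(3)] by (cases y; cases z) auto
  then have x: "x \<in> V" "g \<in> words V" "h \<in> words V" using assms by auto
  obtain s where s: "s \<in> words (star x)" "h \<approx> s @ g"
    using veqE[of x g h] assms(3) x yz by auto
  have "crossing u (s @ g) = crossing u g"
    using s(1)
  proof (induction s)
    case (Cons a s)
    have sV: "s \<in> words V" using Cons.prems words_mono star_subset[OF x(1)] by auto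
    have False if "fst a = u" "in_sub (star u) (s @ g)"
    proof -
      have "vstar u (x, s @ g)"
        using that Cons.prems sV x assms star_sym by (intro vstar_fixes) auto
      moreover have "veq (x, s @ g) (x, g)"
        using Cons.prems sV x by (intro veq_sub in_subI) auto
      ultimately show False
        using assms(5) vcomm_cong_imp[of "(x, s @ g)" "(x, g)" "base u" "base u"] by (simp add: yz)
    qed
    then show ?case using Cons by auto
  qed simp
  then show ?thesis using crossing_cong[OF s(2), of u] by (simp add: level_def yz)
qed

text \<open>Adjacent vertices have a common conjugator, and the level is computed from the
  conjugator alone.\<close>

lemma level_vadj:
  assumes "vadj y z" "y \<in> vert" "z \<in> vert" "u \<in> V" "\<not> vstar u y" "\<not> vstar u z"
  shows "level u y = level u z"
proof -
  obtain k where k: "k \<in> words V" "veq y (fst y, k)" "veq z (fst z, k)"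
    using vadjE assms by metis
  have "level u y = level u (fst y, k)" 
    using k assms by (intro level_veq) (auto simp: mem_Times_iff)
  also have "\<dots> = level u (fst z, k)" by (simp add: level_def)
  also have "\<dots> = level u z" 
    using k assms by (intro level_veq[symmetric]) (auto simp: mem_Times_iff)
  finally show ?thesis .
qed

lemma level_base [simp]: "level u (base x) = 0"
  by (simp add: level_def)

lemma level_act:
  "in_sub (star u) s \<Longrightarrow> s \<in> words V \<Longrightarrow> level u (act s y) = level u y + crossing u s"
  by (simp add: level_def act_def crossing_append_star)

definition gen_power :: "'v \<Rightarrow> int \<Rightarrow> 'v word" where
  "gen_power u n = replicate (nat \<bar>n\<bar>) (u, n \<ge> 0)"

lemma gen_power_words [simp]: "u \<in> A \<Longrightarrow> gen_power u n \<in> words A"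
  by (auto simp: gen_power_def words_def)

lemma crossing_gen_power [simp]: "crossing u (gen_power u n) = n"
proof -
  have "crossing u (replicate k (u, b)) = (if b then int k else - int k)" for k b
  proof (induction k)
    case (Suc k)
    have "in_sub (star u) (replicate k (u, b))"
      by (rule in_subI) (auto simp: words_def star_iff)
    then show ?case using Suc by auto
  qed simp
  then show ?thesis by (simp add: gen_power_def)
qed

section \<open>Walls and shadows\<close>

text \<open>The standard generators whose star separates \<open>y\<close> from the standard copy of the graph.\<close>

definition walls :: "'v \<times> 'v word \<Rightarrow> 'v set" where
  "walls y = {u \<in> V. \<not> vstar u y \<and> level u y \<noteq> 0}"

lemma walls_cong: "y \<in> vert \<Longrightarrow> z \<in> vert \<Longrightarrow> veq y z \<Longrightarrow> walls y = walls z"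
  unfolding walls_def using level_veq[of y z] vcomm_cong[of y z "base u" "base u" for u] 
  by (intro Collect_cong conj_cong refl) auto

lemma walls_base [simp]: "walls (base x) = {}"
  by (simp add: walls_def)

text \<open>The last letter \<open>(u, b)\<close> of a shortest conjugator gives a wall. If the
  vertex commuted with \<open>u\<close>, that letter could be dropped; if the level were 0, the rest
  \<open>g'\<close> could be rewritten to end in the inverse letter, which cancels.\<close>

lemma walls_nonempty:
  assumes "y \<in> vert" "\<not> veq y (base (fst y))"
  shows "walls y \<noteq> {}"
proof -
  define x where "x = fst y"
  have ex: "\<exists>g. g \<in> words V \<and> veq y (x, g)" using assms by (auto simp: x_def intro!: exI[of _ "snd y"])
  define g where "g = (ARG_MIN length g. g \<in> words V \<and> veq y (x, g))"
  have g: "g \<in> words V" "veq y (x, g)"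
    using arg_min_natI[of "\<lambda>g. g \<in> words V \<and> veq y (x, g)" _ length] ex 
    unfolding g_def by blast+
  have min: "length g \<le> length h" if "h \<in> words V" "veq y (x, h)" for h
    using arg_min_nat_le[of "\<lambda>g. g \<in> words V \<and> veq y (x, g)" h length] that unfolding g_def by simp
  have x: "x \<in> V" using assms by (auto simp: x_def)
  obtain g' u b where g': "g = g' @ [(u, b)]"
    using g(2) assms(2) by (cases g rule: rev_cases) (auto simp: x_def)
  have u: "u \<in> V" "g' \<in> words V" using g g' by auto
  have "u \<in> walls (x, g)"
    unfolding walls_def
  proof (intro CollectI conjI notI)
    assume "vstar u (x, g)"
    then have "(x, g) \<in> vert \<Longrightarrow> vx (x, g) @ [(u, True)] \<approx> [(u, True)] @ vx (x, g)"
      by (simp add: vcomm_def raag_commute_def vx_pair)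
    then have c: "in_sub (star u) (vx (x, g))"
      using u x g by (intro centralizer) (auto simp: req_sym)
    have "vx (act [(u, \<not> b)] (x, g)) \<approx> vx (x, g)"
    proof -
      have "[(u, b)] @ vx (x, g) @ [(u, \<not> b)] \<approx> (vx (x, g) @ [(u, b)]) @ [(u, \<not> b)]"
        using req_append_right[OF star_commute[OF c u(1), of b], of "[(u, \<not> b)]"] by simp
      also have "\<dots> \<approx> vx (x, g)"
        using raag_eq.cancel[of u V E "vx (x, g)" b "[]"] u by simp
      finally show ?thesis by (simp add: vx_act)
    qed
    then have "veq y (x, g @ [(u, \<not> b)])"
      using veq_trans[OF g(2) veq_sym] by (simp add: veq_def act_def)
    moreover have "veq (x, g @ [(u, \<not> b)]) (x, g')"
      using g u raag_eq.cancel[of u V E g' b "[]"] by (intro veq_word) (auto simp: g')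
    ultimately have "veq y (x, g')" by (rule veq_trans)
    then show False using min[of g'] u g' by simp
  next
    assume "level u (x, g) = 0"
    then have "crossing u g' + crossing u [(u, b)] = 0"
      using crossing_append_star[of u "[(u, b)]" g'] in_subI[of "[(u, b)]" "star u"] u
      by (simp add: level_def g' star_iff)
    then have "crossing u g' * (if \<not> b then 1 else -1) > 0"
      using in_subI[of "[]" "star u"] by (auto split: if_splits)
    then obtain w where w: "w \<in> words V" "g' \<approx> w @ [(u, \<not> b)]" "length g' = Suc (length w)"
      using crossing_pos_ends[OF u(2)] by blast
    have "g \<approx> (w @ [(u, \<not> b)]) @ [(u, b)]" unfolding g' using w(2) by (rule req_append_right)
    also have "\<dots> \<approx> w" using raag_eq.cancel[of u V E w "\<not> b" "[]"] u by simp
    finally have "veq (x, g) (x, w)" using g by (intro veq_word)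
    then have "veq y (x, w)" using veq_trans[OF g(2)] by simp
    then show False using min[of w] w g' by simp
  qed (fact u)
  then show ?thesis using walls_cong[OF assms(1) _ g(2)] x g by auto
qed

lemma walls_clique: "y \<in> vert \<Longrightarrow> u \<in> walls y \<Longrightarrow> u' \<in> walls y \<Longrightarrow> u = u' \<or> E u u'"
  using crossing_clique[of "snd y" u u'] by (auto simp: walls_def level_def star_iff)

text \<open>A common conjugator of \<open>y\<close> and \<open>c\<close> lies in the subgroup of
  \<open>star c\<close>, so only generators in \<open>star c\<close> can have nonzero crossing
  number; \<open>c\<close> itself commutes with \<open>y\<close>.\<close>

lemma walls_link:
  assumes "y \<in> vert" "c \<in> V" "vadj y (base c)" "u \<in> walls y"
  shows "E c u"
proof -
  obtain k where k: "k \<in> words V" "veq y (fst y, k)" "veq (base c) (c, k)"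
    using vadjE[OF assms(3,1)] assms(2) by auto
  obtain s where s: "s \<in> words (star c)" "k \<approx> s @ []"
    using veqE[OF k(3) assms(2)] k by auto
  then have "in_sub (star c) k" using in_subI in_sub_cong by auto
  moreover have "crossing u k \<noteq> 0"
    using walls_cong[of y "(fst y, k)"] k assms 
    by (auto simp: walls_def level_def)
  ultimately have "u \<in> star c" using crossing_eq_0_sub by blast
  moreover have "u \<noteq> c" using assms by (auto simp: walls_def vadj_def)
  ultimately show ?thesis by (simp add: star_iff)
qed

text \<open>A relation and not a function, since a vertex may have several walls; the freedom of
  choice is used to shorten ears.\<close>

definition shadow :: "'v \<times> 'v word \<Rightarrow> 'v \<Rightarrow> bool" where
  "shadow y c \<longleftrightarrow> c \<in> V \<and> (veq y (base c) \<or> c \<in> walls y)"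

lemma shadow_exists: "y \<in> vert \<Longrightarrow> \<exists>c. shadow y c"
  using walls_nonempty[of y] unfolding shadow_def walls_def mem_Times_iff by blast

lemma shadow_adj_base:
  assumes "z \<in> vert" "c \<in> V" "vadj (base c) z" "shadow z d"
  shows "E c d"
proof (cases "d \<in> walls z")
  case True
  then show ?thesis using walls_link[OF assms(1,2) vadj_sym] assms(3) by blast
next
  case False
  then have "veq z (base d)" using assms by (simp add: shadow_def)
  then show ?thesis using assms vadjE[of "base c" z] veq_fst[of z "base d"] by auto
qed

text \<open>Let \<open>c\<close> be a wall of \<open>y\<close>. Either \<open>z\<close> commutes
  with \<open>c\<close>, and then the walls of \<open>z\<close> are adjacent to \<open>c\<close>; or
  the level is carried over, \<open>c\<close> is a wall of \<open>z\<close>, and walls of one vertex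
  form a clique.\<close>

lemma shadow_adj:
  assumes "y \<in> vert" "z \<in> vert" "vadj y z" "shadow y c" "shadow z d"
  shows "c = d \<or> E c d"
proof -
  have V: "c \<in> V" "d \<in> V" using assms by (auto simp: shadow_def)
  have base: "E c d" if "veq y (base c)" "shadow z d" "vadj y z" "z \<in> vert" "c \<in> V" for y z c d
    using that vadj_cong[of y "base c" z z] by (intro shadow_adj_base[of z]) auto
  show ?thesis
  proof (cases "veq y (base c) \<or> veq z (base d)")
    case True
    then show ?thesis using base[of y c z d] base[of z d y c] assms V vadj_sym[of y z] E_sym[of d c] by blast
  next
    case False
    then have w: "c \<in> walls y" "d \<in> walls z" using assms by (auto simp: shadow_def)
    show ?thesis
    proof (cases "vstar c z")
      case True
      have "\<not> veq z (base c)"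
        using walls_cong[of z "base c"] w assms V by auto
      then show ?thesis using True walls_link[of z c d] assms w V by (auto simp: vadj_def)
    next
      case False
      then have "c \<in> walls z" using w level_vadj[of y z c] assms by (auto simp: walls_def)
      then show ?thesis using walls_clique assms w by blast
    qed
  qed
qed

end

lemma successively_remdups_adj_weak:
  "successively (\<lambda>x y. x = y \<or> P x y) xs \<Longrightarrow> successively P (remdups_adj xs)"
  by (induction xs rule: remdups_adj.induct) (auto simp: successively_Cons)

lemma length_remdups_adj_less: "\<not> distinct_adj xs \<Longrightarrow> length (remdups_adj xs) < length xs"
proof (induction xs rule: remdups_adj.induct)
  case (3 x y xs)
  then show ?case using remdups_adj_length[of "y # xs"] by (auto simp del: remdups_adj_length)
qed auto

lemma rtranclp_restrict_walk:
  assumes "(\<lambda>x y. x \<in> S \<and> y \<in> S \<and> R x y)\<^sup>*\<^sup>* a b" "a \<in> S"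
  shows "\<exists>zs. zs \<noteq> [] \<and> hd zs = a \<and> last zs = b \<and> set zs \<subseteq> S \<and> successively R zs"
  using assms
proof (induction rule: rtranclp_induct)
  case base
  then show ?case by (intro exI[of _ "[a]"]) auto
next
  case (step y z)
  then obtain zs where "zs \<noteq> []" "hd zs = a" "last zs = y" "set zs \<subseteq> S" "successively R zs"
    by blast
  then show ?case using step by (intro exI[of _ "zs @ [z]"]) (auto simp: successively_append_iff)
qed

context raag
begin

lemma act_inverse: "k \<in> words V \<Longrightarrow> veq (act (word_inv k) (x, k)) (base x)"
  using veq_word[OF _ word_inv_right, of k x] by (simp add: act_def)

lemma act_star_base: "x \<in> V \<Longrightarrow> s \<in> words V \<Longrightarrow> in_sub (star x) s \<Longrightarrow> veq (act s (base x)) (base x)"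
  using veq_sub[of x s "[]"] by (simp add: act_def)

text \<open>The element a^m b^n centralizes \<open>a\<close> and \<open>b\<close>, and acting by it
  shifts the levels with respect to \<open>a\<close> and \<open>b\<close> independently.\<close>

lemma edge_twist:
  assumes "E a b"
  obtains s where "s \<in> words V" "in_sub (star a) s" "in_sub (star b) s" 
    "crossing a s = m" "crossing b s = n"
proof
  let ?s = "gen_power a m @ gen_power b n"
  have V: "a \<in> V" "b \<in> V" "a \<noteq> b" "E b a" using assms E_V E_sym E_irrefl by auto
  show "?s \<in> words V" using V by simp
  show "in_sub (star a) ?s" "in_sub (star b) ?s"
    using assms V by (auto intro!: in_subI simp: star_iff)
  have "in_sub (star a) (gen_power b n)" "in_sub (star b) (gen_power b n)"
    using assms by (auto intro!: in_subI simp: star_iff)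
  then show "crossing a ?s = m" "crossing b ?s = n"
    using crossing_append_star V crossing_eq_0[of "gen_power b n" "{b}" a] 
      crossing_eq_0[of "gen_power a m" "{a}" b] by auto
qed

end

section \<open>Embeddings of atomic graphs\<close>

locale atomic_raag =
  fixes V :: "'v set" and E :: "'v \<Rightarrow> 'v \<Rightarrow> bool"
  assumes atomic: "atomic_graph V E"
begin

sublocale raag V E
  using atomic by unfold_locales (simp add: atomic_graph_def)

lemma triangle_free: "E a b \<Longrightarrow> E b c \<Longrightarrow> E c a \<Longrightarrow> False"
  using atomic unfolding atomic_graph_def by blast

lemma square_free: "E a b \<Longrightarrow> E b c \<Longrightarrow> E c d \<Longrightarrow> E d a \<Longrightarrow> a = c \<or> b = d"
  using atomic unfolding atomic_graph_def by blast

lemma star_complement_connected: "v \<in> V \<Longrightarrow> connected_on (V - star v) E"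
  using atomic unfolding atomic_graph_def by blast

text \<open>One edge of the square is moved to the standard edge from \<open>a\<close> to
  \<open>b\<close>; shadows \<open>c\<close> and \<open>d\<close> of the other two corners then
  close up to a triangle or a square in the atomic graph.\<close>

lemma ext_square_free:
  assumes vert: "x1 \<in> vert" "y1 \<in> vert" "x2 \<in> vert" "y2 \<in> vert"
    and adj: "vadj x1 y1" "vadj y1 x2" "vadj x2 y2" "vadj y2 x1"
  shows "veq x1 x2 \<or> veq y1 y2"
proof (rule ccontr)
  assume neq: "\<not> (veq x1 x2 \<or> veq y1 y2)"
  define a b where "a = fst x1" "b = fst y1"
  obtain k where k: "E a b" "k \<in> words V" "veq x1 (a, k)" "veq y1 (b, k)"
    using vadjE[OF adj(1)] vert unfolding a_b_def by metis
  have V: "a \<in> V" "b \<in> V" using k E_V by auto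
  \<comment> \<open>Conjugating by powers of the commuting generators \<open>a\<close> and \<open>b\<close> moves \<open>x2\<close> and \<open>y2\<close> to
    level 0, so that their shadows differ from \<open>a\<close> and \<open>b\<close>.\<close>
  obtain s where s: "s \<in> words V" "in_sub (star a) s" "in_sub (star b) s" 
      "crossing a s = - level a (act (word_inv k) x2)" 
      "crossing b s = - level b (act (word_inv k) y2)"
    using edge_twist[OF k(1)] by metis
  define h where "h = word_inv k @ s"
  have h: "h \<in> words V" using k s by (simp add: h_def)
  have act_h: "act h y = act s (act (word_inv k) y)" for y by (simp add: h_def act_act)
  have std: "veq (act h y) (base c)" if "veq y (c, k)" "c \<in> V" "in_sub (star c) s" for y c
  proof -
    have "veq (act h y) (act s (act (word_inv k) (c, k)))" using that k s by (simp add: act_h)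
    also have "veq (act s (act (word_inv k) (c, k))) (act s (base c))"
      using s act_inverse k by simp
    also have "veq (act s (base c)) (base c)" using that s by (intro act_star_base)
    finally show ?thesis .
  qed
  have X1: "veq (act h x1) (base a)" and Y1: "veq (act h y1) (base b)"
    using std k V s by auto
  have lev: "level a (act h x2) = 0" "level b (act h y2) = 0"
    using level_act s by (auto simp: act_h)
  obtain c d where cd: "shadow (act h x2) c" "shadow (act h y2) d"
    using shadow_exists vert h act_vert by meson
  have "c \<noteq> a"
  proof
    assume "c = a"
    then have "veq (act h x2) (base a)" using cd lev by (auto simp: shadow_def walls_def)
    then have "veq (act h x1) (act h x2)" using X1 veq_sym veq_trans by metis
    then show False using neq h by simp
  qed
  moreover have "d \<noteq> b"
  proof
    assume "d = b"
    then have "veq (act h y2) (base b)" using cd lev by (auto simp: shadow_def walls_def)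
    then have "veq (act h y1) (act h y2)" using Y1 veq_sym veq_trans by metis
    then show False using neq h by simp
  qed
  moreover have "E b c"
  proof (rule shadow_adj_base)
    show "vadj (base b) (act h x2)" 
      using adj(2) vadj_cong[OF Y1, of "act h x2" "act h x2"] h by simp
  qed (use cd h V vert in auto)
  moreover have "E a d"
  proof (rule shadow_adj_base)
    show "vadj (base a) (act h y2)" 
      using vadj_sym[OF adj(4)] vadj_cong[OF X1, of "act h y2" "act h y2"] h by simp
  qed (use cd h V vert in auto)
  moreover have "c = d \<or> E c d"
    using shadow_adj[of "act h x2" "act h y2"] adj(3) cd h vert by auto
  ultimately show False
    using k(1) triangle_free[of a b c] square_free[of a b c d] E_sym by metis
qed

text \<open>The inner vertices may repeat, because shadows of walks are again only walks.\<close>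

definition ear :: "'v set \<Rightarrow> 'v \<Rightarrow> 'v list \<Rightarrow> 'v \<Rightarrow> bool" where
  "ear K w zs w' \<longleftrightarrow> w \<in> K \<and> w' \<in> K \<and> w \<noteq> w' \<and> zs \<noteq> [] \<and> set zs \<subseteq> V - K \<and>
     successively E (w # zs @ [w'])"

text \<open>A neighbour \<open>x\<close> of \<open>w\<close> has a further neighbour, as its valence
  is not 1; this one is not adjacent to \<open>w\<close>, as there are no triangles.\<close>

lemma escapes_star:
  assumes "x \<in> X" "w \<notin> X" "\<And>x y. x \<in> X \<Longrightarrow> E x y \<Longrightarrow> y \<in> insert w X"
  shows "\<exists>y\<in>X. y \<notin> star w"
proof (cases "E w x")
  case True
  have "card {u \<in> V. E x u} \<noteq> 1"
    using atomic E_V True unfolding atomic_graph_def by blast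
  then have "{u \<in> V. E x u} \<noteq> {w}" by auto
  then obtain u where u: "E x u" "u \<noteq> w" using True E_V E_sym by blast
  then have "u \<in> X" "\<not> E w u" using assms triangle_free[of w x u] True E_sym by blast+
  then show ?thesis using u by (auto simp: star_iff)
next
  case False
  then have "x \<notin> star w" using assms(1,2) by (auto simp: star_iff)
  then show ?thesis using assms(1) by blast
qed

text \<open>Without ears, a component \<open>C\<close> of the complement of \<open>K\<close> meets
  \<open>K\<close> through a single vertex \<open>w\<close>. Both \<open>C\<close> and the rest
  \<open>D\<close> reach beyond \<open>star w\<close>, so \<open>star w\<close> would separate the
  graph.\<close>

lemma ear_exists:
  assumes K: "K \<subseteq> V" "K \<noteq> V" "a \<in> K" "b \<in> K" "E a b"
  shows "\<exists>w zs w'. ear K w zs w'"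
proof (rule ccontr)
  assume no_ear: "\<not> ?thesis"
  let ?R = "\<lambda>x y. x \<in> V - K \<and> y \<in> V - K \<and> E x y"
  obtain z where z: "z \<in> V - K" using K by auto
  define C where "C = {c. ?R\<^sup>*\<^sup>* z c}"
  have zC: "z \<in> C" by (simp add: C_def)
  have CV: "C \<subseteq> V - K"
  proof
    fix c assume "c \<in> C"
    then have "?R\<^sup>*\<^sup>* z c" by (simp add: C_def)
    then show "c \<in> V - K" by (induction rule: rtranclp_induct) (use z in auto)
  qed
  have step: "y \<in> C \<or> y \<in> K" if "x \<in> C" "E x y" for x y
  proof -
    have "?R\<^sup>*\<^sup>* z y" if "y \<notin> K"
    proof (rule rtranclp.rtrancl_into_rtrancl)
      show "?R\<^sup>*\<^sup>* z x" using \<open>x \<in> C\<close> by (simp add: C_def)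
      show "?R x y" using CV \<open>x \<in> C\<close> \<open>E x y\<close> E_V(2)[OF \<open>E x y\<close>] that by auto
    qed
    then show ?thesis by (auto simp: C_def)
  qed
  have unique: "w = w'" if "w \<in> K" "w' \<in> K" "c \<in> C" "c' \<in> C" "E c w" "E c' w'" for w w' c c'
  proof (rule ccontr)
    assume "w \<noteq> w'"
    have sym: "symp ?R" by (rule sympI) (use E_sym in blast)
    have "?R\<^sup>*\<^sup>* c z" using sympD[OF symp_rtranclp[OF sym]] that by (simp add: C_def)
    moreover have "?R\<^sup>*\<^sup>* z c'" using that by (simp add: C_def)
    ultimately have "?R\<^sup>*\<^sup>* c c'" by (rule rtranclp_trans)
    then obtain zs where zs: "zs \<noteq> []" "hd zs = c" "last zs = c'" "set zs \<subseteq> V - K" "successively E zs"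
      using rtranclp_restrict_walk[of "V - K" E c c'] subsetD[OF CV \<open>c \<in> C\<close>] by metis
    then have "ear K w zs w'"
      using that \<open>w \<noteq> w'\<close> E_sym[OF \<open>E c w\<close>]
      by (auto simp: ear_def successively_Cons successively_append_iff)
    then show False using no_ear by blast
  qed
  have stays: "y \<in> C" if "(\<lambda>x y. x \<in> S \<and> y \<in> S \<and> E x y)\<^sup>*\<^sup>* x y" "x \<in> C" 
    "\<And>x y. x \<in> C \<Longrightarrow> y \<in> S \<Longrightarrow> E x y \<Longrightarrow> y \<notin> K" for S x y
    using that
  proof (induction rule: rtranclp_induct)
    case (step y z)
    then show ?case using \<open>\<And>x y. x \<in> C \<Longrightarrow> E x y \<Longrightarrow> y \<in> C \<or> y \<in> K\<close> by blast
  qed auto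
  have "connected_on V E" using atomic by (simp add: atomic_graph_def)
  then have "(\<lambda>x y. x \<in> V \<and> y \<in> V \<and> E x y)\<^sup>*\<^sup>* z a"
    using z K unfolding connected_on_def by blast
  then have "\<exists>c\<in>C. \<exists>w\<in>K. E c w" 
    using stays[of V z a] zC subsetD[OF CV, of a] K(3) by blast
  then obtain c w where w: "c \<in> C" "w \<in> K" "E c w" by blast
  define D where "D = V - insert w C"
  have wC: "w \<notin> C" using w CV by auto
  have C_closed: "y \<in> insert w C" if "x \<in> C" "E x y" for x y
    using step[OF that] unique[OF _ w(2) that(1) w(1) that(2) w(3)] by blast
  have D_closed: "y \<in> insert w D" if "x \<in> D" "E x y" for x y
  proof -
    have "y \<notin> C" using C_closed[of y x] that(1) E_sym[OF that(2)] unfolding D_def by blast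
    then show ?thesis using E_V(2)[OF that(2)] by (auto simp: D_def)
  qed
  have "\<exists>x\<in>C. x \<notin> star w" using zC wC C_closed by (rule escapes_star)
  then obtain x where x: "x \<in> C" "x \<notin> star w" by blast
  have "a \<noteq> b" using K E_irrefl by auto
  then obtain e where e: "e \<in> D" using K CV unfolding D_def by blast
  have wD: "w \<notin> D" by (simp add: D_def)
  have "\<exists>y\<in>D. y \<notin> star w" using e wD D_closed by (rule escapes_star)
  then obtain y where y: "y \<in> D" "y \<notin> star w" by blast
  have "x \<in> V - star w" "y \<in> V - star w" using x y CV by (auto simp: D_def)
  then have "(\<lambda>x y. x \<in> V - star w \<and> y \<in> V - star w \<and> E x y)\<^sup>*\<^sup>* x y"
    using star_complement_connected[of w] w K(1) unfolding connected_on_def by blast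
  then have "y \<in> C"
  proof (rule stays)
    fix u v assume "u \<in> C" "v \<in> V - star w" "E u v"
    then show "v \<notin> K" using C_closed[of u v] CV by (auto simp: star_iff)
  qed fact
  then show False using y by (auto simp: D_def)
qed

end

section \<open>Embeddings and standard position\<close>

locale ext_embedding = atomic_raag V E for V :: "'v set" and E +
  fixes \<Phi> :: "'v \<Rightarrow> 'v \<times> 'v word"
  assumes Phi_vert: "v \<in> V \<Longrightarrow> \<Phi> v \<in> vert"
    and Phi_inj: "u \<in> V \<Longrightarrow> v \<in> V \<Longrightarrow> veq (\<Phi> u) (\<Phi> v) \<Longrightarrow> u = v"
    and Phi_comm: "u \<in> V \<Longrightarrow> v \<in> V \<Longrightarrow> u \<noteq> v \<Longrightarrow> E u v \<longleftrightarrow> vcomm (\<Phi> u) (\<Phi> v)"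
begin

abbreviation q :: "'v \<Rightarrow> 'v" where
  "q v \<equiv> fst (\<Phi> v)"

lemma q_V: "v \<in> V \<Longrightarrow> q v \<in> V"
  using Phi_vert[of v] by auto

lemma Phi_vadj: "u \<in> V \<Longrightarrow> v \<in> V \<Longrightarrow> vadj (\<Phi> u) (\<Phi> v) \<longleftrightarrow> E u v"
  using Phi_comm[of u v] Phi_inj[of u v] E_irrefl[of u] veq_refl[of "\<Phi> u"]
  unfolding vadj_def by (cases "u = v") auto

lemma q_hom: "E u v \<Longrightarrow> E (q u) (q v)"
  using Phi_vadj[of u v] vadjE[of "\<Phi> u" "\<Phi> v"] Phi_vert E_V by metis

lemma not_vstar_act:
  assumes "h \<in> words V" "x \<in> V" "veq (act h (\<Phi> x)) (base u)" "v \<in> V - star x"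
  shows "\<not> vstar u (act h (\<Phi> v))"
proof
  assume "vstar u (act h (\<Phi> v))"
  then have "vcomm (act h (\<Phi> v)) (act h (\<Phi> x))"
    using vcomm_cong_imp[of _ _ "base u" "act h (\<Phi> x)"] assms(3) veq_sym veq_refl by metis
  then have "E v x" using Phi_comm[of v x] assms by (auto simp: star_iff)
  then show False using assms E_sym by (auto simp: star_iff)
qed

text \<open>The complement of \<open>star x\<close> is connected, and the image of a walk in it
  never meets the star of \<open>u\<close>, so the level is constant along it.\<close>

lemma level_constant:
  assumes "h \<in> words V" "x \<in> V" "veq (act h (\<Phi> x)) (base u)" "v \<in> V - star x" "v' \<in> V - star x"
  shows "level u (act h (\<Phi> v)) = level u (act h (\<Phi> v'))"
proof -
  have u: "u \<in> V" using veq_fst[OF assms(3)] q_V assms by auto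
  have "(\<lambda>x' y. x' \<in> V - star x \<and> y \<in> V - star x \<and> E x' y)\<^sup>*\<^sup>* v v'"
    using star_complement_connected[OF assms(2)] assms(4,5) unfolding connected_on_def by blast
  then show ?thesis
  proof (induction rule: rtranclp_induct)
    case (step y z)
    have "level u (act h (\<Phi> y)) = level u (act h (\<Phi> z))"
      using step not_vstar_act[OF assms(1-3)] Phi_vert Phi_vadj assms u
      by (intro level_vadj) auto
    with step show ?case by simp
  qed simp
qed

text \<open>\<open>standard_on K h\<close>: conjugation by \<open>h\<close> carries the image of \<open>K\<close> into the standard copy, and no
  star of a vertex in that image separates the conjugated embedding from the standard copy.\<close>

definition standard_on :: "'v set \<Rightarrow> 'v word \<Rightarrow> bool" where
  "standard_on K h \<longleftrightarrow> h \<in> words V \<and> (\<forall>x\<in>K. veq (act h (\<Phi> x)) (base (q x)) \<and>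
     (\<forall>v\<in>V - star x. level (q x) (act h (\<Phi> v)) = 0))"

text \<open>A common conjugator makes the edge standard; the levels with respect to its ends are
  then constants \<open>m\<close> and \<open>n\<close>, which a twist along the edge
  cancels.\<close>

lemma standard_on_edge: 
  assumes "E a b" shows "\<exists>h. standard_on {a, b} h"
proof -
  have V: "a \<in> V" "b \<in> V" "q a \<in> V" "q b \<in> V" using assms E_V q_V by auto
  obtain k where k: "E (q a) (q b)" "k \<in> words V" "veq (\<Phi> a) (q a, k)" "veq (\<Phi> b) (q b, k)"
    using vadjE[of "\<Phi> a" "\<Phi> b"] Phi_vadj[of a b] Phi_vert assms V by metis
  have std: "veq (act (word_inv k) (\<Phi> x)) (base (q x))" if "veq (\<Phi> x) (q x, k)" for x
    using veq_trans[OF _ act_inverse[OF k(2)], of "act (word_inv k) (\<Phi> x)"] that k by simp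
  have "\<exists>n. \<forall>v\<in>V - star x. level (q x) (act (word_inv k) (\<Phi> v)) = n" 
    if "x \<in> V" "veq (\<Phi> x) (q x, k)" for x
    using level_constant[OF _ that(1) std[OF that(2)]] k(2) by (metis word_inv_words)
  then obtain m n where
    m: "\<forall>v\<in>V - star a. level (q a) (act (word_inv k) (\<Phi> v)) = m" and
    n: "\<forall>v\<in>V - star b. level (q b) (act (word_inv k) (\<Phi> v)) = n"
    using V k by meson
  obtain s where s: "s \<in> words V" "in_sub (star (q a)) s" "in_sub (star (q b)) s" 
      "crossing (q a) s = - m" "crossing (q b) s = - n"
    using edge_twist[OF k(1)] by metis
  have act_s: "act (word_inv k @ s) y = act s (act (word_inv k) y)" for y by (simp add: act_act)
  have "veq (act (word_inv k @ s) (\<Phi> x)) (base (q x))" 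
    if "veq (\<Phi> x) (q x, k)" "q x \<in> V" "in_sub (star (q x)) s" for x
    unfolding act_s using std[OF that(1)] that s
    by (intro veq_trans[OF _ act_star_base[of "q x" s]]) auto
  moreover have "level (q a) (act (word_inv k @ s) (\<Phi> v)) = 0" if "v \<in> V - star a" for v
    unfolding act_s using level_act s m that by auto
  moreover have "level (q b) (act (word_inv k @ s) (\<Phi> v)) = 0" if "v \<in> V - star b" for v
    unfolding act_s using level_act s n that by auto
  ultimately show ?thesis using V k s 
    by (intro exI[of _ "word_inv k @ s"]) (auto simp: standard_on_def)
qed

lemma standard_on_inj: 
  assumes "standard_on K h" "K \<subseteq> V" shows "inj_on q K"
proof (rule inj_onI)
  fix x y assume xy: "x \<in> K" "y \<in> K" "q x = q y"
  then have "veq (act h (\<Phi> x)) (base (q x))" "veq (act h (\<Phi> y)) (base (q x))"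
    using assms by (auto simp: standard_on_def)
  then have "veq (act h (\<Phi> x)) (act h (\<Phi> y))" using veq_sym veq_trans by metis
  then show "x = y" using assms xy Phi_inj[of x y] by (auto simp: standard_on_def)
qed

text \<open>No \<open>d z\<close> lies in the image of \<open>K\<close>: if
  \<open>d z = q x\<close>, then either the image of \<open>z\<close> equals that of
  \<open>x\<close>, against injectivity, or \<open>q x\<close> is a wall of it, against
  standardness. Since adjacent vertices may share a shadow, repetitions are removed.\<close>

lemma shadow_ear:
  assumes K: "standard_on K h" "K \<subseteq> V" and ear: "ear K w zs w'"
    and d: "\<And>v. v \<in> V \<Longrightarrow> shadow (act h (\<Phi> v)) (d v)" "\<And>x. x \<in> K \<Longrightarrow> d x = q x"
  shows "ear (q ` K) (q w) (remdups_adj (map d zs)) (q w')"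
proof -
  have h: "h \<in> words V" using K by (simp add: standard_on_def)
  have outside: "d z \<notin> q ` K" if z: "z \<in> V - K" for z
  proof
    assume "d z \<in> q ` K"
    then obtain x where x: "x \<in> K" "d z = q x" by auto
    have std: "veq (act h (\<Phi> x)) (base (q x))" using K x by (simp add: standard_on_def)
    show False
    proof (cases "veq (act h (\<Phi> z)) (base (q x))")
      case True
      then have "veq (act h (\<Phi> z)) (act h (\<Phi> x))" using std veq_sym veq_trans by metis
      then show False using Phi_inj[of z x] h x z K by auto
    next
      case False
      then have wall: "q x \<in> walls (act h (\<Phi> z))" using d(1)[of z] x z by (auto simp: shadow_def)
      have "z \<notin> star x"
      proof
        assume "z \<in> star x"
        then have "E x z" using x z by (auto simp: star_iff)
        then have "vcomm (act h (\<Phi> z)) (act h (\<Phi> x))"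
          using Phi_vadj[of z x] E_sym[of x z] x z K h by (auto simp: vadj_def)
        then have "vstar (q x) (act h (\<Phi> z))" 
          using vcomm_cong_imp[OF veq_refl std] by blast
        then show False using wall by (simp add: walls_def)
      qed
      then show False using wall K x z by (auto simp: walls_def standard_on_def)
    qed
  qed
  have hom: "d u = d v \<or> E (d u) (d v)" if "E u v" for u v
    using that Phi_vadj[of u v] Phi_vert E_V[OF that] h d(1)
    by (intro shadow_adj[of "act h (\<Phi> u)" "act h (\<Phi> v)"]) auto
  have zs: "w \<in> K" "w' \<in> K" "w \<noteq> w'" "zs \<noteq> []" "set zs \<subseteq> V - K" "successively E zs" 
    "E w (hd zs)" "E (last zs) w'"
    using ear by (auto simp: ear_def successively_Cons successively_append_iff)
  have "successively (\<lambda>x y. x = y \<or> E x y) (map d zs)"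
    unfolding successively_map using zs(6) hom by (rule successively_mono)
  then have "successively E (remdups_adj (map d zs))" by (rule successively_remdups_adj_weak)
  moreover have "hd zs \<in> V - K" "last zs \<in> V - K" using zs(4,5) hd_in_set last_in_set by blast+
  then have "E (q w) (d (hd zs))" "E (d (last zs)) (q w')"
    using hom[OF zs(7)] hom[OF zs(8)] d(2)[OF zs(1)] d(2)[OF zs(2)] zs(1,2) outside
    by (metis imageI)+
  moreover have "set (remdups_adj (map d zs)) \<subseteq> V - q ` K"
    using zs outside d(1) by (auto simp: shadow_def)
  moreover have "q w \<noteq> q w'" using standard_on_inj[OF K] zs by (auto dest: inj_onD)
  ultimately show ?thesis
    using zs unfolding ear_def 
    by (auto simp: successively_Cons successively_append_iff hd_map last_map hd_append)
qed

text \<open>Take the first nonstandard \<open>z\<close> of the ear, its neighbours \<open>p\<close>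
  and \<open>n\<close> on the walk, and a wall \<open>c\<close> of its image. Either
  \<open>c\<close> is also a wall at \<open>n\<close>, or \<open>n\<close> is adjacent to
  \<open>c\<close>; each case yields a shorter ear.\<close>

lemma shortest_ear_standard:
  assumes K: "standard_on K h" "K \<subseteq> V" and ear: "ear K w zs w'"
    and min: "\<And>u us u'. ear K u us u' \<Longrightarrow> length zs \<le> length us"
    and min': "\<And>u us u'. ear (q ` K) u us u' \<Longrightarrow> length zs \<le> length us"
    and z: "z \<in> set zs"
  shows "veq (act h (\<Phi> z)) (base (q z))"
proof (rule ccontr)
  define Y where "Y v = act h (\<Phi> v)" for v
  have h: "h \<in> words V" using K by (simp add: standard_on_def)
  have Y_vert: "v \<in> V \<Longrightarrow> Y v \<in> vert" for v using Phi_vert h by (simp add: Y_def)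
  have Y_adj: "u \<in> V \<Longrightarrow> v \<in> V \<Longrightarrow> vadj (Y u) (Y v) \<longleftrightarrow> E u v" for u v
    using Phi_vadj h by (simp add: Y_def)
  have Y_K: "x \<in> K \<Longrightarrow> veq (Y x) (base (q x))" for x using K by (simp add: standard_on_def Y_def)
  assume "\<not> veq (act h (\<Phi> z)) (base (q z))"
  then have "\<exists>z\<in>set zs. \<not> veq (Y z) (base (q z))" using z by (auto simp: Y_def)
  from split_list_first_prop[OF this] obtain ys z ts where split: "zs = ys @ z # ts" 
    "\<not> veq (Y z) (base (q z))" "\<And>y. y \<in> set ys \<Longrightarrow> veq (Y y) (base (q y))" by blast
  define p n where "p = last (w # ys)" "n = hd (ts @ [w'])"
  have sub: "set zs \<subseteq> V - K" "w \<in> K" "w' \<in> K" "w \<noteq> w'" using ear by (auto simp: ear_def)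
  have zV: "z \<in> V - K" using split sub by auto
  have "successively E ((w # ys) @ z # (ts @ [w']))" using ear split by (simp add: ear_def)
  then have walk: "successively E (w # ys)" "successively E (ts @ [w'])" "E p z" "E z n"
    unfolding p_n_def by (subst (asm) successively_append_iff; simp add: successively_Cons)+
  have pn: "p \<in> V" "n \<in> V" using E_V(1)[OF walk(3)] E_V(2)[OF walk(4)] by auto
  have Y_p: "veq (Y p) (base (q p))" 
    using Y_K[OF sub(2)] split(3) by (auto simp: p_n_def)
  have n_K: "n = w'" if "n \<in> K" using that sub(1) split(1) by (cases ts) (auto simp: p_n_def)
  have ts_n: "\<exists>ts'. ts = n # ts'" if "n \<notin> K" 
    using that sub(3) by (cases ts) (auto simp: p_n_def)
  obtain c where c: "c \<in> walls (Y z)" using walls_nonempty[OF Y_vert] split(2) zV by (auto simp: Y_def)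
  then have cV: "c \<in> V" by (simp add: walls_def)
  obtain d0 where d0: "\<And>v. v \<in> V \<Longrightarrow> shadow (Y v) (d0 v)"
    using shadow_exists[OF Y_vert] by metis
  show False
  proof (cases "c \<in> walls (Y n)")
    case True
    \<comment> \<open>Both \<open>z\<close> and \<open>n\<close> can be sent to \<open>c\<close>, which yields a shorter ear.\<close>
    have "n \<notin> K" using walls_cong[OF Y_vert[OF pn(2)] _ Y_K] True q_V pn by auto
    then obtain ts' where ts: "ts = n # ts'" using ts_n by blast
    define d where "d v = (if v \<in> K then q v else if v = z \<or> v = n then c else d0 v)" for v
    have "ear (q ` K) (q w) (remdups_adj (map d zs)) (q w')"
    proof (rule shadow_ear[OF K ear])
      show "shadow (act h (\<Phi> v)) (d v)" if "v \<in> V" for v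
        using d0[OF that] True c cV Y_K[of v] q_V[OF that] unfolding d_def Y_def[symmetric] 
        by (auto simp: shadow_def)
    qed (simp add: d_def)
    then have "length zs \<le> length (remdups_adj (map d zs))" by (rule min')
    moreover have "\<not> distinct_adj (map d zs)"
      using zV \<open>n \<notin> K\<close> 
      by (auto simp: split ts d_def distinct_adj_def successively_append_iff successively_Cons)
    ultimately show False using length_remdups_adj_less by force
  next
    case False
    have not_z: "\<not> vstar c (Y z)" "level c (Y z) \<noteq> 0" using c by (auto simp: walls_def)
    have zn: "vadj (Y z) (Y n)" and pz: "vadj (Y p) (Y z)" using Y_adj walk pn zV by auto
    have "vstar c (Y n)"
    proof (rule ccontr)
      assume "\<not> vstar c (Y n)"
      then have "level c (Y z) = level c (Y n)"
        using zn Y_vert pn zV cV not_z(1) by (intro level_vadj) auto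
      then show False using False \<open>\<not> vstar c (Y n)\<close> not_z(2) cV by (auto simp: walls_def)
    qed
    moreover have "\<not> veq (Y n) (base c)"
      using zn vcomm_cong_imp[of "Y z" "Y z" "Y n" "base c"] not_z(1) by (auto simp: vadj_def)
    ultimately have nc: "vadj (Y n) (base c)" by (simp add: vadj_def)
    have "vadj (base (q p)) (Y z)" using vadj_cong[OF Y_p veq_refl] pz by blast
    then have "E (q p) c"
      using shadow_adj_base[of "Y z" "q p" c] Y_vert zV q_V pn c cV by (auto simp: shadow_def)
    then have "vadj (base c) (base (q p))" using vadj_conj[OF E_sym] by simp
    then have cp: "vadj (base c) (Y p)" using vadj_cong[OF veq_refl Y_p] by blast
    \<comment> \<open>The images of \<open>p\<close>, \<open>z\<close>, \<open>n\<close> together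
      with \<open>c\<close> form a closed walk of length 4.\<close>
    have "veq (Y p) (Y n) \<or> veq (Y z) (base c)"
      using ext_square_free[OF _ _ _ _ pz zn nc cp] Y_vert pn zV cV by auto
    moreover have "\<not> veq (Y z) (base c)" using not_z veq_vcomm by blast
    ultimately have "p = n" using Phi_inj[OF pn] h by (simp add: Y_def)
    \<comment> \<open>The walk backtracks at \<open>z\<close>, so it can be shortened.\<close>
    have "ys \<noteq> []"
    proof
      assume "ys = []"
      then have "p = w" by (simp add: p_n_def(1))
      then show False using n_K \<open>p = n\<close> sub(2,4) by simp
    qed
    then have last: "p = last ys" "p \<in> set ys" by (simp_all add: p_n_def(1))
    then have "n \<notin> K" using sub(1) split(1) \<open>p = n\<close> by auto
    then obtain ts' where ts: "ts = n # ts'" using ts_n by blast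
    have "ear K w (ys @ ts') w'"
      using walk(1,2) sub split(1) \<open>ys \<noteq> []\<close> last(1) \<open>p = n\<close>
      by (cases ts') (auto simp: ear_def ts successively_Cons successively_append_iff)
    then show False using min[of w "ys @ ts'" w'] by (simp add: split ts)
  qed
qed

text \<open>Only the level condition at a new \<open>z\<close> needs proof. By triangle-freeness
  \<open>a\<close> or \<open>b\<close> lies outside \<open>star z\<close>; its standard image has
  level 0, and the level is constant off \<open>star z\<close>.\<close>

lemma standard_on_union:
  assumes K: "standard_on K h" "K \<subseteq> V" "a \<in> K" "b \<in> K" "E a b"
    and Z: "Z \<subseteq> V" "\<And>z. z \<in> Z \<Longrightarrow> veq (act h (\<Phi> z)) (base (q z))"
  shows "standard_on (K \<union> Z) h"
proof -
  have "level (q z) (act h (\<Phi> v)) = 0" if "z \<in> Z - K" "v \<in> V - star z" for z v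
  proof -
    have "a \<notin> star z \<or> b \<notin> star z"
      using K(3-5) that(1) triangle_free[of z a b] E_sym[of z b] by (auto simp: star_iff)
    then obtain x where x: "x \<in> K" "x \<notin> star z" using K(3,4) by blast
    have h: "h \<in> words V" using K by (simp add: standard_on_def)
    have "level (q z) (act h (\<Phi> v)) = level (q z) (act h (\<Phi> x))"
      using x K Z that h by (intro level_constant[of h z]) auto
    also have "\<dots> = level (q z) (base (q x))"
      using x K Z that h Phi_vert q_V not_vstar_act[OF h, of z "q z" x]
      by (intro level_veq) (auto simp: standard_on_def)
    finally show ?thesis by simp
  qed
  then show ?thesis using K(1) Z by (auto simp: standard_on_def)
qed

section \<open>Maximal admissible sets\<close>

definition admissible :: "'v set \<Rightarrow> bool" where
  "admissible K \<longleftrightarrow> K \<subseteq> V \<and> (\<exists>a\<in>K. \<exists>b\<in>K. E a b) \<and> (\<forall>i. \<exists>h. standard_on ((q ^^ i) ` K) h)"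

text \<open>Passing to the image shifts the sequence of iterates by one; \<open>q\<close> is
  injective wherever the embedding is standard.\<close>

lemma admissible_q: 
  assumes "admissible K" shows "admissible (q ` K)" "card (q ` K) = card K"
proof -
  have *: "(q ^^ i) ` q ` K = (q ^^ Suc i) ` K" for i
    by (simp add: image_comp funpow_Suc_right del: funpow.simps)
  show "admissible (q ` K)"
    using assms q_V q_hom unfolding admissible_def * by blast
  obtain h where "standard_on ((q ^^ 0) ` K) h" using assms unfolding admissible_def by blast
  then show "card (q ` K) = card K"
    using standard_on_inj[of K h] assms by (auto simp: admissible_def card_image)
qed

lemma admissible_edge: 
  assumes "E a b" shows "admissible {a, b}"
proof -
  have "E ((q ^^ i) a) ((q ^^ i) b)" for i by (induction i) (use assms q_hom in auto)
  then show ?thesis using standard_on_edge assms E_V by (auto simp: admissible_def)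
qed

lemma standard_on_V:
  assumes "E a b" shows "\<exists>h. standard_on V h"
proof -
  have "admissible {a, b}" using assms by (rule admissible_edge)
  moreover have "\<forall>K. admissible K \<longrightarrow> card K < Suc (card V)"
    using finite_V by (auto simp: admissible_def card_mono less_Suc_eq_le)
  ultimately have "\<exists>K0. admissible K0 \<and> (\<forall>K. admissible K \<longrightarrow> card K \<le> card K0)"
    by (rule ex_has_greatest_nat)
  then obtain K0 where K0: "admissible K0" "\<And>K. admissible K \<Longrightarrow> card K \<le> card K0"
    by blast
  show ?thesis
  proof (cases "K0 = V")
    case True
    then have "\<exists>h. standard_on ((q ^^ 0) ` V) h" using K0 unfolding admissible_def by blast
    then show ?thesis by simp
  next
    case False
    \<comment> \<open>The minimum runs over all admissible sets of maximal size, since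
      \<open>q\<close> carries one such set to another.\<close>
    define cand where "cand n \<longleftrightarrow> 
      (\<exists>K w zs w'. admissible K \<and> card K = card K0 \<and> ear K w zs w' \<and> length zs = n)" for n
    have "\<exists>w zs w'. ear K0 w zs w'"
      using ear_exists[of K0] False K0(1) unfolding admissible_def by blast
    then have "\<exists>n. cand n" using K0(1) unfolding cand_def by blast
    then have "cand (LEAST n. cand n)" by (rule LeastI_ex)
    then obtain K w zs w' where K: "admissible K" "card K = card K0" "ear K w zs w'"
      "length zs = (LEAST n. cand n)" unfolding cand_def by blast
    have min: "length zs \<le> length us" if "admissible L" "card L = card K0" "ear L u us u'" for L u us u'
      unfolding K(4) using that by (intro Least_le) (auto simp: cand_def)
    have KV: "K \<subseteq> V" "set zs \<subseteq> V - K" "zs \<noteq> []" using K by (auto simp: admissible_def ear_def)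
    let ?K = "\<lambda>i. (q ^^ i) ` K"
    have adm: "admissible (?K i) \<and> card (?K i) = card K0" for i
    proof (induction i)
      case (Suc i)
      then show ?case using admissible_q[of "?K i"] by (simp add: image_comp)
    qed (use K in auto)
    \<comment> \<open>Shortest ears of \<open>q ^^ i\<close>-images are carried to shortest ears, hence into the standard copy.\<close>
    have main: "\<exists>h. standard_on (?K i \<union> (q ^^ i) ` set zs) h \<and> 
        ear (?K (Suc i)) ((q ^^ Suc i) w) (map (q ^^ Suc i) zs) ((q ^^ Suc i) w')" 
      if ear: "ear (?K i) ((q ^^ i) w) (map (q ^^ i) zs) ((q ^^ i) w')" for i
    proof -
      let ?zs = "map (q ^^ i) zs"
      obtain h where h: "standard_on (?K i) h" using K(1) unfolding admissible_def by blast
      have KiV: "?K i \<subseteq> V" using adm[of i] by (simp add: admissible_def)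
      have zsV: "set ?zs \<subseteq> V - ?K i" using ear by (simp add: ear_def)
      have qKi: "q ` ?K i = ?K (Suc i)" by (simp add: image_comp)
      have std: "veq (act h (\<Phi> z)) (base (q z))" if "z \<in> set ?zs" for z
      proof (rule shortest_ear_standard[OF h KiV ear _ _ that])
        show "length ?zs \<le> length us" if "ear (?K i) u us u'" for u us u'
          using min[OF _ _ that] adm[of i] by simp
        show "length ?zs \<le> length us" if "ear (q ` ?K i) u us u'" for u us u'
          using min[of "?K (Suc i)" u us u'] that adm[of "Suc i"] qKi by simp
      qed
      obtain a b where "a \<in> ?K i" "b \<in> ?K i" "E a b" using adm[of i] unfolding admissible_def by blast
      then have union: "standard_on (?K i \<union> set ?zs) h"
        using standard_on_union[OF h KiV, of a b "set ?zs"] std zsV by blast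
      \<comment> \<open>Injectivity on the union keeps the image of the ear outside the image of
        \<open>K\<close>, with the same length.\<close>
      then have inj: "inj_on q (?K i \<union> set ?zs)" using KiV zsV by (intro standard_on_inj) auto
      have "ear (q ` ?K i) (q ((q ^^ i) w)) (map q ?zs) (q ((q ^^ i) w'))"
        unfolding ear_def
      proof (intro conjI)
        show "q ((q ^^ i) w) \<noteq> q ((q ^^ i) w')"
          using ear inj unfolding ear_def inj_on_def by blast
        show "set (map q ?zs) \<subseteq> V - q ` ?K i"
        proof
          fix y assume "y \<in> set (map q ?zs)"
          then obtain z where z: "z \<in> set ?zs" "y = q z" by auto
          then have "z \<in> V" "z \<notin> ?K i" using zsV by auto
          then show "y \<in> V - q ` ?K i"
            using inj_onD[OF inj, of z] z q_V by (auto simp del: set_map)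
        qed
        have "successively E ((q ^^ i) w # ?zs @ [(q ^^ i) w'])" using ear by (simp add: ear_def)
        then have "successively E (map q ((q ^^ i) w # ?zs @ [(q ^^ i) w']))"
          unfolding successively_map by (rule successively_mono) (rule q_hom)
        then show "successively E (q ((q ^^ i) w) # map q ?zs @ [q ((q ^^ i) w')])" by simp
      qed (use ear in \<open>auto simp: ear_def\<close>)
      then have "ear (?K (Suc i)) ((q ^^ Suc i) w) (map (q ^^ Suc i) zs) ((q ^^ Suc i) w')"
        using qKi by (simp add: comp_def)
      then show ?thesis using union by auto
    qed
    have "ear (?K i) ((q ^^ i) w) (map (q ^^ i) zs) ((q ^^ i) w')" for i
    proof (induction i)
      case 0
      then show ?case using K(3) by simp
    next
      case (Suc i)
      then show ?case using main by blast
    qed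
    then have "\<exists>h. standard_on ((q ^^ i) ` (K \<union> set zs)) h" for i
      using main[of i] by (auto simp: image_Un)
    \<comment> \<open>The edge comes from \<open>K\<close>, the conjugators from
      \<open>main\<close>; the union exceeds the maximal size.\<close>
    then have "admissible (K \<union> set zs)" using K(1) KV by (auto simp: admissible_def)
    then have "card (K \<union> set zs) \<le> card K" using K0 K by simp
    moreover have "K \<subset> K \<union> set zs" using KV by (cases zs) auto
    ultimately show ?thesis
      using psubset_card_mono[of "K \<union> set zs" K] finite_subset[OF KV(1) finite_V] by simp
  qed
qed

end

section \<open>The automorphism and the conjugator\<close>

theorem mainTheorem6:
  fixes V :: "'v set" and E :: "'v \<Rightarrow> 'v \<Rightarrow> bool" and \<phi> :: "'v \<Rightarrow> 'v word"
  assumes "atomic_graph V E"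
    and "induced_ext_embedding V E \<phi>"
  shows "\<exists>g\<in>words V. \<exists>\<alpha>. graph_automorphism V E \<alpha> \<and>
           (\<forall>v\<in>V. raag_eq V E (\<phi> (\<alpha> v)) (conj_gen g v))"
proof -
  interpret atomic_raag V E using assms(1) by unfold_locales
  have "\<forall>v\<in>V. \<exists>y. y \<in> vert \<and> \<phi> v \<approx> vx y"
    using assms(2) by (fastforce simp: induced_ext_embedding_def ext_vertex_def vx_def)
  then obtain \<Phi> where \<Phi>: "\<And>v. v \<in> V \<Longrightarrow> \<Phi> v \<in> vert" "\<And>v. v \<in> V \<Longrightarrow> \<phi> v \<approx> vx (\<Phi> v)"
    by metis
  interpret ext_embedding V E \<Phi>
  proof
    show "u = v" if "u \<in> V" "v \<in> V" "veq (\<Phi> u) (\<Phi> v)" for u v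
    proof -
      have "\<phi> u \<approx> vx (\<Phi> u)" using \<Phi>(2) that by blast
      also have "\<dots> \<approx> vx (\<Phi> v)" using that by (simp add: veq_def)
      also have "\<dots> \<approx> \<phi> v" using \<Phi>(2) that by (intro req_sym[OF \<Phi>(2)])
      finally show ?thesis using assms(2) that by (auto simp: induced_ext_embedding_def)
    qed
    show "E u v \<longleftrightarrow> vcomm (\<Phi> u) (\<Phi> v)" if "u \<in> V" "v \<in> V" "u \<noteq> v" for u v
    proof -
      have "E u v \<longleftrightarrow> raag_commute V E (\<phi> u) (\<phi> v)"
        using assms(2) that by (simp add: induced_ext_embedding_def)
      also have "\<dots> \<longleftrightarrow> vcomm (\<Phi> u) (\<Phi> v)"
        unfolding vcomm_def using that(1,2)
        by (blast intro: raag_commute_cong[OF \<Phi>(2) \<Phi>(2)]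
            raag_commute_cong[OF req_sym[OF \<Phi>(2)] req_sym[OF \<Phi>(2)]])
      finally show ?thesis .
    qed
  qed (fact \<Phi>(1))
  show ?thesis
  proof (cases "\<exists>a b. E a b")
    case True
    then obtain h where h: "standard_on V h" using standard_on_V by blast
    then have hw: "h \<in> words V" and std: "\<And>x. x \<in> V \<Longrightarrow> veq (act h (\<Phi> x)) (base (q x))"
      by (auto simp: standard_on_def)
    have inj: "inj_on q V" using h by (rule standard_on_inj) simp
    have "q ` V = V" using finite_V _ inj by (rule endo_inj_surj) (use q_V in blast)
    with inj have bij: "bij_betw q V V" by (rule bij_betw_imageI)
    \<comment> \<open>The image of \<open>\<alpha> v\<close> must be a conjugate of
      \<open>v\<close>, so \<open>\<alpha>\<close> inverts \<open>q\<close>.\<close>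
    define \<alpha> where "\<alpha> = inv_into V q"
    have \<alpha>: "bij_betw \<alpha> V V" unfolding \<alpha>_def using bij by (rule bij_betw_inv_into)
    then have \<alpha>_V: "\<alpha> v \<in> V" if "v \<in> V" for v using that by (rule bij_betw_apply)
    have q_\<alpha>: "q (\<alpha> v) = v" if "v \<in> V" for v
      unfolding \<alpha>_def using bij that by (rule bij_betw_inv_into_right)
    have iso: "E x y \<longleftrightarrow> E (q x) (q y)" if "x \<in> V" "y \<in> V" for x y
    proof
      assume "E (q x) (q y)"
      then have "vadj (base (q x)) (base (q y))" by (rule vadj_conj) simp
      then have "vadj (act h (\<Phi> x)) (act h (\<Phi> y))"
        using vadj_cong[OF std[OF that(1)] std[OF that(2)]] by simp
      then show "E x y" using hw Phi_vadj[OF that] by simp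
    qed (rule q_hom)
    \<comment> \<open>Conjugation by \<open>h\<close> carries the image into the standard copy, so
      the conjugator sought is its inverse.\<close>
    have "word_inv h \<in> words V" using hw by simp
    moreover have "\<phi> (\<alpha> v) \<approx> conj_gen (word_inv h) v" if "v \<in> V" for v
    proof -
      let ?x = "\<alpha> v"
      have "veq (act h (\<Phi> ?x)) (base v)" using std[OF \<alpha>_V[OF that]] q_\<alpha>[OF that] by simp
      also have "veq (base v) (act h (v, word_inv h))"
        using act_inverse[of "word_inv h" v] hw by (simp add: veq_sym)
      finally have "veq (\<Phi> ?x) (v, word_inv h)" using hw by simp
      then show ?thesis
        using raag_eq.trans[OF \<Phi>(2)[OF \<alpha>_V[OF that]]] by (simp add: veq_def vx_def)
    qed
    moreover have "graph_automorphism V E \<alpha>"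
      unfolding graph_automorphism_def
    proof (intro conjI ballI)
      show "E u v \<longleftrightarrow> E (\<alpha> u) (\<alpha> v)" if "u \<in> V" "v \<in> V" for u v
        using iso[OF \<alpha>_V[OF that(1)] \<alpha>_V[OF that(2)]] unfolding q_\<alpha>[OF that(1)] q_\<alpha>[OF that(2)] ..
    qed (fact \<alpha>)
    ultimately show ?thesis by blast
  next
    case False
    have "V \<noteq> {}" using assms(1) by (simp add: atomic_graph_def)
    then obtain x where x: "x \<in> V" by blast
    \<comment> \<open>A connected graph without edges is a single vertex; the conjugator of its
      image then serves.\<close>
    have "y = x" if "y \<in> V" for y
    proof -
      have "(\<lambda>x y. x \<in> V \<and> y \<in> V \<and> E x y)\<^sup>*\<^sup>* x y"
        using assms(1) x that unfolding atomic_graph_def connected_on_def by blast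
      then show ?thesis by (induction rule: rtranclp_induct) (use False in auto)
    qed
    then have V: "V = {x}" using x by blast
    have "q x = x" using q_V[OF x] V by simp
    then have "\<forall>v\<in>V. \<phi> (id v) \<approx> conj_gen (snd (\<Phi> x)) v" using \<Phi>(2)[OF x] V by (simp add: vx_def)
    moreover have "snd (\<Phi> x) \<in> words V" using \<Phi>(1)[OF x] by (simp add: mem_Times_iff)
    moreover have "graph_automorphism V E id" by (simp add: graph_automorphism_def)
    ultimately show ?thesis by blast
  qed
qed

end
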